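(* Let $n\in\mathbb N$ and let $Y=\{0\}^2$ or $Y=\{0\}\times\mathbb C$. Then the operator $A_Y$ associated in $H_Y$ with the form $a(u,v)=\int_0^1u\overline v\,dx$ on $V^{(n)}_{Y,2}$ has domain $D(A_Y)=\{u\in H^1(0,1):\mu_0(u)=\mu_n(u)=0\}$ if $Y=\{0\}^2$, and $D(A_Y)=\{u\in H^1(0,1):\mu_0(u)=0,\ u(0)=u(1)\}$ if $Y=\{0\}\times\mathbb C$; in both cases $A_Yu=\mathrm{Id}_m^{-1}\big(-u''+\gamma(u)(1-x)^{n-2}\big)$.
   Context: Functions are complex-valued. $H^1(T):=\{u\in H^1(0,1):u(0)=u(1)\}$, $H^{-1}(T)$ its (anti)dual with pivot $L^2(0,1)$; $\mathcal D(T)$: $C^\infty$ functions on $[0,1]$ with all derivatives coinciding at $0$ and $1$. For $k\in\mathbb N_0$, $\mu_k(f):=\int_0^1(1-x)^kf\,dx$ ($f\in L^1$), $\mu_0(f):=\langle f,1\rangle$ ($f\in H^{-1}(T)$). $\gamma:H^1(0,1)\to\mathbb C$ is $\gamma(f):=(n-1)(2n-1)f(0)-(n-1)^2(2n-1)\mu_{n-2}(f)$ if $n\ge2$ and $\gamma:=0$ if $n=1$ (the term $\gamma(u)(1-x)^{n-2}$ is then absent). For $f\in H^{-1}(0,1)$, $\mathrm{Id}_m^{-1}f$ is the unique $w\in H^{-1}(T)$ with $\mu_0(w)=0$ whose restriction to $H^1_0(0,1)$ is $f$. $V^{(n)}_{Y,2}:=\{u\in L^2(0,1):(\mu_0(u),\mu_n(u))\in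 Y\}$; $H_Y:=\{f\in H^{-1}(T):\mu_0(f)=0\}$ here, with inner product $(f|g)_{H_Y}:=\int_0^1P_nf\,\overline{P_ng}\,dx+\mu_0(f)\overline{\mu_0(g)}$, where $P_nf$ is the distribution $\varphi\mapsto\langle f,J_n\varphi\rangle$, $J_n\varphi(x):=\int_x^1\varphi\,dy-\mu_0(\varphi)(1-x)^n$. The associated operator: $D(A_Y):=\{f\in V^{(n)}_{Y,2}:\exists g\in H_Y,\ a(f,h)=(g|h)_{H_Y}\ \forall h\in V^{(n)}_{Y,2}\}$, $A_Yf:=g$. *)

theory Defs
  imports "HOL-Analysis.Analysis"
begin

text \<open>All functions are complex valued functions on the real line; only their values on
  [0,1] matter. Integrals are Lebesgue integrals over lebesgue measure restricted to
  the relevant interval.\<close>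

definition int01 :: "(real \<Rightarrow> complex) \<Rightarrow> complex" where
  "int01 f = integral\<^sup>L (lebesgue_on {0..1}) f"

definition L2 :: "(real \<Rightarrow> complex) set" where
  "L2 = {f. f \<in> borel_measurable (lebesgue_on {0..1}) \<and>
            integrable (lebesgue_on {0..1}) (\<lambda>x. (norm (f x))^2)}"

text \<open>u is (the continuous representative of) an element of H^1(0,1) with weak derivative g\<close>
definition is_wderiv :: "(real \<Rightarrow> complex) \<Rightarrow> (real \<Rightarrow> complex) \<Rightarrow> bool" where
  "is_wderiv u g \<longleftrightarrow> g \<in> L2 \<and>
     (\<forall>x\<in>{0..1}. u x = u 0 + integral\<^sup>L (lebesgue_on {0..x}) g)"

definition H1 :: "(real \<Rightarrow> complex) set" where
  "H1 = {u. \<exists>g. is_wderiv u g}"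

definition wderiv :: "(real \<Rightarrow> complex) \<Rightarrow> (real \<Rightarrow> complex)" where
  "wderiv u = (SOME g. is_wderiv u g)"

definition H1T :: "(real \<Rightarrow> complex) set" where
  "H1T = {u \<in> H1. u 0 = u 1}"

definition H10 :: "(real \<Rightarrow> complex) set" where
  "H10 = {u \<in> H1. u 0 = 0 \<and> u 1 = 0}"

definition H1_normsq :: "(real \<Rightarrow> complex) \<Rightarrow> real" where
  "H1_normsq u = Re (int01 (\<lambda>x. complex_of_real ((norm (u x))^2)))
                 + Re (int01 (\<lambda>x. complex_of_real ((norm (wderiv u x))^2)))"

text \<open>Elements of an antidual space: bounded antilinear functionals on a space W of
  H^1-functions (W = H^1(T) gives H^{-1}(T), W = H^1_0 gives H^{-1}(0,1)).
  A functional is represented by a HOL function; only its values on W are relevant.\<close>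
definition antidual :: "(real \<Rightarrow> complex) set \<Rightarrow> ((real \<Rightarrow> complex) \<Rightarrow> complex) set" where
  "antidual W = {F. (\<forall>\<phi>\<in>W. \<forall>\<psi>\<in>W. F (\<lambda>x. \<phi> x + \<psi> x) = F \<phi> + F \<psi>) \<and>
                     (\<forall>\<phi>\<in>W. \<forall>c. F (\<lambda>x. c * \<phi> x) = cnj c * F \<phi>) \<and>
                     (\<exists>C. \<forall>\<phi>\<in>W. (norm (F \<phi>))^2 \<le> C * H1_normsq \<phi>)}"

abbreviation Hm1T :: "((real \<Rightarrow> complex) \<Rightarrow> complex) set" where
  "Hm1T \<equiv> antidual H1T"

abbreviation Hm1 :: "((real \<Rightarrow> complex) \<Rightarrow> complex) set" where
  "Hm1 \<equiv> antidual H10"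

definition emb :: "(real \<Rightarrow> complex) \<Rightarrow> ((real \<Rightarrow> complex) \<Rightarrow> complex)" where
  "emb f = (\<lambda>\<phi>. int01 (\<lambda>x. f x * cnj (\<phi> x)))"

definition mu :: "nat \<Rightarrow> (real \<Rightarrow> complex) \<Rightarrow> complex" where
  "mu k f = int01 (\<lambda>x. complex_of_real ((1 - x) ^ k) * f x)"

definition mu0H :: "((real \<Rightarrow> complex) \<Rightarrow> complex) \<Rightarrow> complex" where
  "mu0H F = F (\<lambda>x. 1)"

definition Jn :: "nat \<Rightarrow> (real \<Rightarrow> complex) \<Rightarrow> (real \<Rightarrow> complex)" where
  "Jn n \<phi> = (\<lambda>x. integral\<^sup>L (lebesgue_on {x..1}) \<phi> - mu 0 \<phi> * complex_of_real ((1 - x) ^ n))"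

definition Pn :: "nat \<Rightarrow> ((real \<Rightarrow> complex) \<Rightarrow> complex) \<Rightarrow> (real \<Rightarrow> complex)" where
  "Pn n F = (SOME p. p \<in> L2 \<and> (\<forall>\<phi>\<in>L2. F (Jn n \<phi>) = int01 (\<lambda>x. p x * cnj (\<phi> x))))"

definition HY :: "((real \<Rightarrow> complex) \<Rightarrow> complex) set" where
  "HY = {F \<in> Hm1T. mu0H F = 0}"

definition HY_inner :: "nat \<Rightarrow> ((real \<Rightarrow> complex) \<Rightarrow> complex) \<Rightarrow> ((real \<Rightarrow> complex) \<Rightarrow> complex) \<Rightarrow> complex" where
  "HY_inner n F G = int01 (\<lambda>x. Pn n F x * cnj (Pn n G x)) + mu0H F * cnj (mu0H G)"

definition VY :: "nat \<Rightarrow> (complex \<times> complex) set \<Rightarrow> (real \<Rightarrow> complex) set" where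
  "VY n Y = {u \<in> L2. (mu 0 u, mu n u) \<in> Y}"

definition form_a :: "(real \<Rightarrow> complex) \<Rightarrow> (real \<Rightarrow> complex) \<Rightarrow> complex" where
  "form_a u v = int01 (\<lambda>x. u x * cnj (v x))"

text \<open>AY_rel n Y u g  means  u \<in> D(A_Y) and A_Y u = g.\<close>
definition AY_rel :: "nat \<Rightarrow> (complex \<times> complex) set \<Rightarrow> (real \<Rightarrow> complex)
                      \<Rightarrow> ((real \<Rightarrow> complex) \<Rightarrow> complex) \<Rightarrow> bool" where
  "AY_rel n Y u g \<longleftrightarrow> u \<in> VY n Y \<and> g \<in> HY \<and>
      (\<forall>h\<in>VY n Y. form_a u h = HY_inner n g (emb h))"

definition DAY :: "nat \<Rightarrow> (complex \<times> complex) set \<Rightarrow> (real \<Rightarrow> complex) set" where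
  "DAY n Y = {u. \<exists>g. AY_rel n Y u g}"

definition gamma :: "nat \<Rightarrow> (real \<Rightarrow> complex) \<Rightarrow> complex" where
  "gamma n f = (if n \<ge> 2 then of_nat ((n - 1) * (2 * n - 1)) * f 0
                    - of_nat ((n - 1)^2 * (2 * n - 1)) * mu (n - 2) f else 0)"

text \<open>-u'' + gamma(u) (1-x)^(n-2) as element of H^{-1}(0,1):
  phi |-> int u' conj(phi') + gamma(u) int (1-x)^(n-2) conj(phi)  (term absent if n = 1)\<close>
definition rhs_dist :: "nat \<Rightarrow> (real \<Rightarrow> complex) \<Rightarrow> ((real \<Rightarrow> complex) \<Rightarrow> complex)" where
  "rhs_dist n u = (\<lambda>\<phi>. int01 (\<lambda>x. wderiv u x * cnj (wderiv \<phi> x))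
       + (if n \<ge> 2 then gamma n u * int01 (\<lambda>x. complex_of_real ((1 - x) ^ (n - 2)) * cnj (\<phi> x))
          else 0))"

definition Idm_inv_rel :: "((real \<Rightarrow> complex) \<Rightarrow> complex) \<Rightarrow> ((real \<Rightarrow> complex) \<Rightarrow> complex) \<Rightarrow> bool" where
  "Idm_inv_rel f w \<longleftrightarrow> w \<in> Hm1T \<and> mu0H w = 0 \<and> (\<forall>\<phi>\<in>H10. w \<phi> = f \<phi>)"

end

theory Submission
  imports Defs
begin

text \<open>
  The operator \<open>J_n\<close> is, up to the functional \<open>\<mu>_n\<close>, the adjoint of integration from 0:
  \<open>(J_n p, h) = (p, H - \<mu>_n(h))\<close> with \<open>H(x)\<close> the integral of \<open>h\<close> over \<open>[0,x]\<close>. Hence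
  \<open>P_n h = H - \<mu>_n(h)\<close> for \<open>h\<close> in \<open>L^2\<close>, and the inner product \<open>(g|h)\<close> in \<open>H_Y\<close> equals the
  \<open>L^2\<close> product of \<open>J_n P_n g\<close> and \<open>h\<close>. So \<open>A_Y u = g\<close> means that
  \<open>u - J_n P_n g\<close> is orthogonal to \<open>V_Y\<close>, that is, lies in the span of \<open>1\<close> and
  \<open>(1-x)^n\<close>, respectively of \<open>1\<close>; as \<open>J_n\<close> maps \<open>L^2\<close> into \<open>H^1_0\<close>, this gives the
  regularity and the boundary conditions of \<open>u\<close>.
  Conversely, for \<open>u\<close> in \<open>H^1\<close> and \<open>w\<close> the stated distribution,
  \<open>J_n P_n w = u - u(1) + (u(1) - u(0)) (1-x)^n\<close>.
\<close>

section \<open>The Hilbert space of square integrable functions\<close>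

abbreviation U :: "real measure" where "U \<equiv> lebesgue_on {0..1}"

definition nsq :: "(real \<Rightarrow> complex) \<Rightarrow> real" where
  "nsq f = (\<integral>x. (norm (f x))\<^sup>2 \<partial>U)"

definition prim :: "(real \<Rightarrow> complex) \<Rightarrow> real \<Rightarrow> complex" where
  "prim f x = integral\<^sup>L (lebesgue_on {0..x}) f"

text \<open>Complex valued, so that moments become inner products:
  \<open>mu k f = form_a f (pw k)\<close>.\<close>

definition pw :: "nat \<Rightarrow> real \<Rightarrow> complex" where
  "pw k x = complex_of_real ((1 - x) ^ k)"

interpretation U: finite_measure U
  by (rule finite_measure_lebesgue_on) simp

lemma L2_measurable: "f \<in> L2 \<Longrightarrow> f \<in> borel_measurable U"
  by (simp add: L2_def)

lemma L2_square_integrable: "f \<in> L2 \<Longrightarrow> integrable U (\<lambda>x. (norm (f x))\<^sup>2)"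
  by (simp add: L2_def)

lemma L2_mult_integrable:
  assumes "f \<in> L2" "g \<in> L2"
  shows "integrable U (\<lambda>x. f x * g x)"
proof (rule Bochner_Integration.integrable_bound)
  show "integrable U (\<lambda>x. (norm (f x))\<^sup>2 + (norm (g x))\<^sup>2)"
    using assms by (simp add: L2_square_integrable)
  show "(\<lambda>x. f x * g x) \<in> borel_measurable U"
    using assms L2_measurable by (intro borel_measurable_times) auto
  have "norm (a * b) \<le> norm ((norm a)\<^sup>2 + (norm b)\<^sup>2)" for a b :: complex
  proof -
    have "2 * (norm a * norm b) \<le> (norm a)\<^sup>2 + (norm b)\<^sup>2"
      using sum_squares_bound[of "norm a" "norm b"] by simp
    moreover have "0 \<le> norm a * norm b" by simp
    ultimately show ?thesis unfolding norm_mult real_norm_def by linarith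
  qed
  then show "AE x in U. norm (f x * g x) \<le> norm ((norm (f x))\<^sup>2 + (norm (g x))\<^sup>2)"
    by simp
qed

lemma L2_cnj: "f \<in> L2 \<Longrightarrow> (\<lambda>x. cnj (f x)) \<in> L2"
  unfolding L2_def
  by (auto intro: measurable_compose[OF _ borel_measurable_continuous_onI[of cnj]] continuous_intros)

lemma L2_inner_integrable:
  "f \<in> L2 \<Longrightarrow> g \<in> L2 \<Longrightarrow> integrable U (\<lambda>x. f x * cnj (g x))"
  by (simp add: L2_mult_integrable L2_cnj)

lemma L2_cmult: "f \<in> L2 \<Longrightarrow> (\<lambda>x. c * f x) \<in> L2"
  unfolding L2_def by (auto simp: norm_mult power_mult_distrib)

lemma L2_add:
  assumes "f \<in> L2" "g \<in> L2"
  shows "(\<lambda>x. f x + g x) \<in> L2"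
proof -
  have [measurable]: "f \<in> borel_measurable U" "g \<in> borel_measurable U"
    using assms L2_measurable by auto
  have "integrable U (\<lambda>x. (norm (f x + g x))\<^sup>2)"
  proof (rule Bochner_Integration.integrable_bound)
    show "integrable U (\<lambda>x. 2 * (norm (f x))\<^sup>2 + 2 * (norm (g x))\<^sup>2)"
      using assms by (simp add: L2_square_integrable)
    show "(\<lambda>x. (norm (f x + g x))\<^sup>2) \<in> borel_measurable U"
      by measurable
    have "(norm (a + b))\<^sup>2 \<le> 2 * (norm a)\<^sup>2 + 2 * (norm b)\<^sup>2" for a b :: complex
    proof -
      have "(norm (a + b))\<^sup>2 \<le> (norm a + norm b)\<^sup>2"
        by (intro power_mono norm_triangle_ineq) auto
      also have "\<dots> \<le> 2 * (norm a)\<^sup>2 + 2 * (norm b)\<^sup>2"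
        using sum_squares_bound[of "norm a" "norm b"] by (simp add: power2_sum)
      finally show ?thesis .
    qed
    then show "AE x in U. norm ((norm (f x + g x))\<^sup>2) \<le> norm (2 * (norm (f x))\<^sup>2 + 2 * (norm (g x))\<^sup>2)"
      by simp
  qed
  then show ?thesis by (simp add: L2_def)
qed

lemma L2_minus: "f \<in> L2 \<Longrightarrow> (\<lambda>x. - f x) \<in> L2"
  using L2_cmult[of f "-1"] by simp

lemma L2_diff: "f \<in> L2 \<Longrightarrow> g \<in> L2 \<Longrightarrow> (\<lambda>x. f x - g x) \<in> L2"
  using L2_add[of f "\<lambda>x. - g x"] by (simp add: L2_minus)

lemma L2_continuous:
  assumes "continuous_on {0..1} f"
  shows "f \<in> L2"
proof -
  have m: "f \<in> borel_measurable U"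
    using assms by (intro continuous_imp_measurable_on_sets_lebesgue) auto
  have "compact (f ` {0..1})"
    using assms by (intro compact_continuous_image) auto
  then obtain B where B: "\<And>x. x \<in> {0..1} \<Longrightarrow> norm (f x) \<le> B"
    by (meson bounded_iff compact_imp_bounded imageI)
  have "integrable U (\<lambda>x. (norm (f x))\<^sup>2)"
  proof (rule U.integrable_const_bound)
    show "AE x in U. norm ((norm (f x))\<^sup>2) \<le> B\<^sup>2"
      by (rule AE_I2) (use B in \<open>auto intro!: power_mono\<close>)
    show "(\<lambda>x. (norm (f x))\<^sup>2) \<in> borel_measurable U"
      using m by measurable
  qed
  with m show ?thesis by (simp add: L2_def)
qed

lemma L2_const: "(\<lambda>x. c) \<in> L2"
  by (intro L2_continuous continuous_intros)

lemma L2_pw: "pw k \<in> L2"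
  unfolding pw_def[abs_def] by (intro L2_continuous continuous_intros)

lemma L2_integrable: "f \<in> L2 \<Longrightarrow> integrable U f"
  using L2_mult_integrable[of f "\<lambda>_. 1"] L2_const by simp

lemma L2_cong:
  assumes "f \<in> L2" "\<And>x. x \<in> {0..1} \<Longrightarrow> f x = g x"
  shows "g \<in> L2"
proof -
  have "f \<in> borel_measurable U \<longleftrightarrow> g \<in> borel_measurable U"
    using assms by (intro measurable_cong) auto
  moreover have "integrable U (\<lambda>x. (norm (f x))\<^sup>2) \<longleftrightarrow> integrable U (\<lambda>x. (norm (g x))\<^sup>2)"
    using assms by (intro Bochner_Integration.integrable_cong) auto
  ultimately show ?thesis using assms by (simp add: L2_def)
qed

lemma L2_indicator:
  assumes f: "f \<in> L2" and A: "A \<in> sets U"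
  shows "(\<lambda>x. indicator A x * f x) \<in> L2"
proof -
  have [measurable]: "f \<in> borel_measurable U" "A \<in> sets U" using f L2_measurable A by auto
  have "integrable U (\<lambda>x. (norm (indicator A x * f x))\<^sup>2)"
    by (rule Bochner_Integration.integrable_bound[OF L2_square_integrable[OF f]])
       (measurable, auto simp: indicator_def)
  then show ?thesis by (simp add: L2_def)
qed

text \<open>Lebesgue measure is complete, so deleting a null set does not affect measurability. This
  is what lets \<open>DAY\<close> be closed under changes on null sets.\<close>

lemma measurable_AE_eq:
  assumes f: "f \<in> borel_measurable U" and eq: "AE x in U. g x = (f x :: complex)"
  shows "g \<in> borel_measurable U"
proof -
  obtain N where N: "N \<in> null_sets U" "{x \<in> space U. \<not> g x = f x} \<subseteq> N"
    using eq unfolding eventually_ae_filter by auto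
  have "f \<in> borel_measurable (lebesgue_on ({0..1} - N))"
    using f borel_measurable_diff_null[OF N(1), of f] by simp
  also have "?this \<longleftrightarrow> g \<in> borel_measurable (lebesgue_on ({0..1} - N))"
    using N by (intro measurable_cong) auto
  finally show ?thesis
    using borel_measurable_diff_null[OF N(1), of g] by simp
qed

lemma L2_AE_eq:
  assumes f: "f \<in> L2" and eq: "AE x in U. g x = f x"
  shows "g \<in> L2"
proof -
  have m: "g \<in> borel_measurable U"
    using measurable_AE_eq[OF L2_measurable[OF f] eq] .
  moreover have "integrable U (\<lambda>x. (norm (g x))\<^sup>2)"
    by (rule integrable_cong_AE_imp[OF L2_square_integrable[OF f]])
       (use m eq in \<open>auto elim: eventually_mono\<close>)
  ultimately show ?thesis by (simp add: L2_def)
qed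

section \<open>Sesquilinearity of the L^2 inner product\<close>

lemma form_a_add_left:
  "f \<in> L2 \<Longrightarrow> g \<in> L2 \<Longrightarrow> h \<in> L2 \<Longrightarrow> form_a (\<lambda>x. f x + g x) h = form_a f h + form_a g h"
  by (simp add: form_a_def int01_def distrib_right L2_inner_integrable)

lemma form_a_cmult_left: "form_a (\<lambda>x. c * f x) h = c * form_a f h"
  by (simp add: form_a_def int01_def mult.assoc)

lemma form_a_diff_left:
  "f \<in> L2 \<Longrightarrow> g \<in> L2 \<Longrightarrow> h \<in> L2 \<Longrightarrow> form_a (\<lambda>x. f x - g x) h = form_a f h - form_a g h"
  by (simp add: form_a_def int01_def left_diff_distrib L2_inner_integrable)

lemma form_a_commute: "form_a g f = cnj (form_a f g)"
  unfolding form_a_def int01_def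
  by (subst Bochner_Integration.integral_cnj[symmetric]) (simp add: mult.commute)

lemma form_a_add_right:
  "f \<in> L2 \<Longrightarrow> g \<in> L2 \<Longrightarrow> h \<in> L2 \<Longrightarrow> form_a h (\<lambda>x. f x + g x) = form_a h f + form_a h g"
  by (simp add: form_a_def int01_def distrib_left L2_inner_integrable)

lemma form_a_cmult_right: "form_a h (\<lambda>x. c * f x) = cnj c * form_a h f"
  by (simp add: form_a_def int01_def mult.left_commute)

lemma form_a_diff_right:
  "f \<in> L2 \<Longrightarrow> g \<in> L2 \<Longrightarrow> h \<in> L2 \<Longrightarrow> form_a h (\<lambda>x. f x - g x) = form_a h f - form_a h g"
  by (simp add: form_a_def int01_def right_diff_distrib L2_inner_integrable)

lemma form_a_cong_AE:
  assumes "f \<in> L2" "h \<in> L2" "AE x in U. f x = f' x" "AE x in U. h x = h' x"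
  shows "form_a f' h' = form_a f h"
proof -
  have f': "f' \<in> L2" and h': "h' \<in> L2"
    by (rule L2_AE_eq[OF assms(1)] L2_AE_eq[OF assms(2)], use assms(3,4) in \<open>auto elim: eventually_mono\<close>)+
  show ?thesis unfolding form_a_def int01_def
  proof (rule integral_cong_AE)
    show "AE x in U. f' x * cnj (h' x) = f x * cnj (h x)"
      using assms(3,4) by eventually_elim simp
  qed (use assms(1,2) f' h' L2_inner_integrable in auto)
qed

lemma form_a_cong:
  assumes "\<And>x. x \<in> {0..1} \<Longrightarrow> f x = f' x" "\<And>x. x \<in> {0..1} \<Longrightarrow> h x = h' x"
  shows "form_a f h = form_a f' h'"
  unfolding form_a_def int01_def using assms by (intro Bochner_Integration.integral_cong) auto

lemma form_a_self: "form_a f f = complex_of_real (nsq f)"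
  by (simp add: form_a_def int01_def nsq_def complex_norm_square[symmetric] del: of_real_power
      flip: integral_complex_of_real)

lemma nsq_nonneg: "0 \<le> nsq f"
  by (simp add: nsq_def)

lemma nsq_eq_0_AE: "f \<in> L2 \<Longrightarrow> nsq f = 0 \<Longrightarrow> AE x in U. f x = 0"
  unfolding nsq_def
  by (subst (asm) integral_nonneg_eq_0_iff_AE) (auto simp: L2_square_integrable)

lemma mu_eq_form_a: "mu k f = form_a f (pw k)"
  by (simp add: mu_def form_a_def pw_def mult.commute)

lemma pw_0: "pw 0 = (\<lambda>x. 1)"
  by (simp add: pw_def fun_eq_iff)

lemma mu_0: "mu 0 f = integral\<^sup>L U f"
  by (simp add: mu_def int01_def)

lemma cauchy_schwarz_L2:
  assumes "f \<in> L2" "g \<in> L2"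
  shows "(norm (form_a f g))\<^sup>2 \<le> nsq f * nsq g"
proof -
  define A where "A = form_a f g"
  have nn: "0 \<le> nsq f - 2 * t * (norm A)\<^sup>2 + t\<^sup>2 * (norm A)\<^sup>2 * nsq g" for t :: real
  proof -
    \<comment> \<open>The factor \<open>A\<close> makes both cross terms equal to the real number
      \<open>t * |A|^2\<close>, so a real parameter suffices.\<close>
    define c where "c = complex_of_real t * A"
    have "complex_of_real (nsq (\<lambda>x. f x - c * g x)) = form_a (\<lambda>x. f x - c * g x) (\<lambda>x. f x - c * g x)"
      by (rule form_a_self[symmetric])
    also have "\<dots> = form_a f f - cnj c * form_a f g - c * (form_a g f - cnj c * form_a g g)"
      using assms by (simp add: form_a_diff_left form_a_diff_right L2_cmult L2_diff form_a_cmult_left form_a_cmult_right right_diff_distrib)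
    also have "\<dots> = complex_of_real (nsq f) - cnj c * A - c * cnj A + c * cnj c * complex_of_real (nsq g)"
      unfolding form_a_commute[of g f] by (simp add: form_a_self A_def algebra_simps)
    also have "\<dots> = complex_of_real (nsq f - 2 * t * (norm A)\<^sup>2 + t\<^sup>2 * (norm A)\<^sup>2 * nsq g)"
      using complex_norm_square[of A] by (simp add: c_def algebra_simps power2_eq_square)
    finally show ?thesis
      using nsq_nonneg[of "\<lambda>x. f x - c * g x"] by (simp only: of_real_eq_iff)
  qed
  show ?thesis
  proof (cases "nsq g = 0")
    case True
    have "AE x in U. g x = 0" using nsq_eq_0_AE assms True by blast
    then have "form_a f g = form_a f (\<lambda>x. 0)"
      using assms by (intro form_a_cong_AE[symmetric, THEN sym]) (auto simp: L2_const elim!: eventually_mono)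
    then show ?thesis using True by (simp add: form_a_def int01_def)
  next
    case False
    then have pos: "nsq g > 0" using nsq_nonneg[of g] by simp
    \<comment> \<open>The value \<open>t = 1 / nsq g\<close> minimises the quadratic.\<close>
    have "0 \<le> nsq f - (norm A)\<^sup>2 / nsq g"
      using nn[of "1 / nsq g"] pos by (simp add: power2_eq_square field_simps)
    then show ?thesis using pos by (simp add: A_def field_simps)
  qed
qed

lemma nsq_parallelogram:
  assumes "f \<in> L2" "g \<in> L2"
  shows "nsq (\<lambda>x. f x + g x) + nsq (\<lambda>x. f x - g x) = 2 * nsq f + 2 * nsq g"
proof -
  have "complex_of_real (nsq (\<lambda>x. f x + g x) + nsq (\<lambda>x. f x - g x)) = complex_of_real (2 * nsq f + 2 * nsq g)"
    unfolding of_real_add form_a_self[symmetric] of_real_mult using assms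
    by (simp add: form_a_add_left form_a_add_right form_a_diff_left form_a_diff_right L2_add L2_diff)
  then show ?thesis by (simp only: of_real_eq_iff)
qed

lemma nsq_cmult: "nsq (\<lambda>x. c * f x) = (norm c)\<^sup>2 * nsq f"
  by (simp add: nsq_def norm_mult power_mult_distrib)

lemma nsq_add_cmult:
  assumes "f \<in> L2" "g \<in> L2"
  shows "nsq (\<lambda>x. f x + complex_of_real t * g x) = nsq f + 2 * t * Re (form_a f g) + t\<^sup>2 * nsq g"
proof -
  have "complex_of_real (nsq (\<lambda>x. f x + complex_of_real t * g x))
     = form_a f f + complex_of_real t * (form_a f g + form_a g f) + complex_of_real (t\<^sup>2) * form_a g g"
    unfolding form_a_self[symmetric] using assms
    by (simp add: form_a_add_left form_a_add_right L2_cmult L2_add form_a_cmult_left form_a_cmult_right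
        algebra_simps power2_eq_square)
  also have "form_a f g + form_a g f = complex_of_real (2 * Re (form_a f g))"
    unfolding form_a_commute[of g f] by (rule complex_add_cnj)
  finally show ?thesis
    unfolding form_a_self by (simp only: of_real_eq_iff flip: of_real_add of_real_mult)
qed

section \<open>Completeness and Riesz representation\<close>

lemma measure_U [simp]: "measure U {0..1} = 1"
  by (simp add: measure_restrict_space)

lemma summable_half_power: "summable (\<lambda>k. c * (1/2::real) ^ k)"
  by (intro summable_mult summable_geometric) simp

text \<open>Integrate \<open>(t |f| - 1)^2 / t >= 0\<close> over \<open>U\<close>, which has total
  mass 1. The free weight \<open>t\<close> is there to be balanced against a decaying
  \<open>nsq f\<close>.\<close>

lemma L2_norm_integral_le:
  assumes f: "f \<in> L2" and t: "t > 0"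
  shows "(\<integral>x. norm (f x) \<partial>U) \<le> (t * nsq f + 1 / t) / 2"
proof -
  have "(\<integral>x. norm (f x) \<partial>U) \<le> (\<integral>x. (t * (norm (f x))\<^sup>2 + 1 / t) / 2 \<partial>U)"
  proof (rule integral_mono)
    show "integrable U (\<lambda>x. norm (f x))" using f by (simp add: L2_integrable)
    show "integrable U (\<lambda>x. (t * (norm (f x))\<^sup>2 + 1 / t) / 2)"
      using f by (simp add: L2_square_integrable)
    fix x
    have "0 \<le> (t * norm (f x) - 1)\<^sup>2 / t" using t by simp
    also have "\<dots> = t * (norm (f x))\<^sup>2 - 2 * norm (f x) + 1 / t"
      using t by (simp add: power2_eq_square field_simps)
    finally show "norm (f x) \<le> (t * (norm (f x))\<^sup>2 + 1 / t) / 2" by simp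
  qed
  also have "\<dots> = (t * nsq f + 1 / t) / 2"
    using f by (simp add: L2_square_integrable nsq_def)
  finally show ?thesis .
qed

text \<open>The Riesz-Fischer argument: the increments have summable L^1 norms, so the sequence
  converges almost everywhere, and Fatou's lemma carries the Cauchy bound over to the limit.\<close>

lemma L2_rapidly_Cauchy_limit:
  assumes F: "\<And>k. F k \<in> L2"
    and cauchy: "\<And>k m. k \<le> m \<Longrightarrow> nsq (\<lambda>x. F m x - F k x) \<le> B * (1/4) ^ k"
  obtains p where "p \<in> L2" "\<And>k. nsq (\<lambda>x. p x - F k x) \<le> B * (1/4) ^ k"
proof -
  have [measurable]: "F k \<in> borel_measurable U" for k
    using F L2_measurable by auto
  define D where "D k x = norm (F (Suc k) x - F k x)" for k x
  have D_meas[measurable]: "D k \<in> borel_measurable U" for k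
    unfolding D_def[abs_def] by measurable
  have D_int: "integrable U (D k)" for k
    unfolding D_def[abs_def] by (intro integrable_norm L2_integrable L2_diff F)
  have D_le: "(\<integral>x. D k x \<partial>U) \<le> (B + 1) / 2 * (1/2) ^ k" for k
  proof -
    \<comment> \<open>The weight \<open>t = 2^k\<close> turns the decay \<open>(1/4)^k\<close> of
      the squared norms into \<open>(1/2)^k\<close> for the L^1 norms.\<close>
    have "(\<integral>x. D k x \<partial>U) \<le> (2 ^ k * nsq (\<lambda>x. F (Suc k) x - F k x) + 1 / 2 ^ k) / 2"
      unfolding D_def by (rule L2_norm_integral_le) (auto intro: L2_diff F)
    also have "\<dots> \<le> (2 ^ k * (B * (1/4) ^ k) + 1 / 2 ^ k) / 2"
      using cauchy[of k "Suc k"] by simp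
    also have "2 ^ k * (B * (1/4) ^ k) = B * (1/2) ^ k"
      using power_mult_distrib[of "2::real" "1/4" k] by simp
    finally show ?thesis by (simp add: power_one_over field_simps)
  qed
  have "(\<integral>\<^sup>+x. (\<Sum>k. ennreal (D k x)) \<partial>U) = (\<Sum>k. \<integral>\<^sup>+x. ennreal (D k x) \<partial>U)"
    by (rule nn_integral_suminf) simp
  also have "\<dots> = (\<Sum>k. ennreal (\<integral>x. D k x \<partial>U))"
    by (intro suminf_cong nn_integral_eq_integral D_int) (simp add: D_def)
  also have "\<dots> \<noteq> \<infinity>"
    unfolding infinity_ennreal_def
  proof (rule ennreal_suminf_neq_top)
    show "summable (\<lambda>k. \<integral>x. D k x \<partial>U)"
      by (rule summable_comparison_test[OF _ summable_half_power[of "(B + 1) / 2"]])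
         (use D_le in \<open>auto simp: D_def\<close>)
  qed (simp add: D_def)
  finally have "AE x in U. (\<Sum>k. ennreal (D k x)) \<noteq> \<infinity>"
    by (intro nn_integral_PInf_AE) auto
  then have conv: "AE x in U. (\<lambda>k. F k x) \<longlonglongrightarrow> lim (\<lambda>k. F k x)"
  proof (rule eventually_mono)
    fix x assume "(\<Sum>k. ennreal (D k x)) \<noteq> \<infinity>"
    then have "summable (\<lambda>k. D k x)"
      by (intro summable_suminf_not_top) (auto simp: D_def)
    then have "summable (\<lambda>k. F (Suc k) x - F k x)"
      unfolding D_def by (rule summable_norm_cancel)
    then have "(\<lambda>n. (\<Sum>k<n. F (Suc k) x - F k x) + F 0 x) \<longlonglongrightarrow> (\<Sum>k. F (Suc k) x - F k x) + F 0 x"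
      by (intro tendsto_add summable_LIMSEQ tendsto_const)
    then have "convergent (\<lambda>n. F n x)"
      by (auto simp: sum_lessThan_telescope[of "\<lambda>k. F k x"] convergent_def)
    then show "(\<lambda>k. F k x) \<longlonglongrightarrow> lim (\<lambda>k. F k x)"
      by (simp add: convergent_LIMSEQ_iff)
  qed
  \<comment> \<open>Where the sequence diverges, \<open>lim\<close> is an unspecified value; this
    happens only on a null set.\<close>
  define p where "p x = lim (\<lambda>k. F k x)" for x
  have p_meas[measurable]: "p \<in> borel_measurable U"
    unfolding p_def[abs_def] by measurable
  have fatou: "(\<integral>\<^sup>+x. ennreal ((norm (p x - F k x))\<^sup>2) \<partial>U) \<le> ennreal (B * (1/4) ^ k)" for k
  proof -
    have "(\<integral>\<^sup>+x. ennreal ((norm (p x - F k x))\<^sup>2) \<partial>U)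
        \<le> (\<integral>\<^sup>+x. liminf (\<lambda>m. ennreal ((norm (F m x - F k x))\<^sup>2)) \<partial>U)"
    proof (rule nn_integral_mono_AE)
      show "AE x in U. ennreal ((norm (p x - F k x))\<^sup>2) \<le> liminf (\<lambda>m. ennreal ((norm (F m x - F k x))\<^sup>2))"
        using conv
      proof (rule eventually_mono)
        fix x assume "(\<lambda>k. F k x) \<longlonglongrightarrow> lim (\<lambda>k. F k x)"
        then have "(\<lambda>m. ennreal ((norm (F m x - F k x))\<^sup>2)) \<longlonglongrightarrow> ennreal ((norm (p x - F k x))\<^sup>2)"
          unfolding p_def by (intro tendsto_intros)
        then have "liminf (\<lambda>m. ennreal ((norm (F m x - F k x))\<^sup>2)) = ennreal ((norm (p x - F k x))\<^sup>2)"
          by (intro lim_imp_Liminf) auto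
        then show "ennreal ((norm (p x - F k x))\<^sup>2) \<le> liminf (\<lambda>m. ennreal ((norm (F m x - F k x))\<^sup>2))"
          by simp
      qed
    qed
    also have "\<dots> \<le> liminf (\<lambda>m. \<integral>\<^sup>+x. ennreal ((norm (F m x - F k x))\<^sup>2) \<partial>U)"
      by (rule nn_integral_liminf) measurable
    also have "\<dots> \<le> liminf (\<lambda>m. ennreal (B * (1/4) ^ k))"
    proof (rule Liminf_mono)
      have "(\<integral>\<^sup>+x. ennreal ((norm (F m x - F k x))\<^sup>2) \<partial>U) = ennreal (nsq (\<lambda>x. F m x - F k x))" for m
        unfolding nsq_def by (intro nn_integral_eq_integral L2_square_integrable L2_diff F) simp
      \<comment> \<open>Only indices \<open>m >= k\<close> are controlled, which is enough for the
        lower limit.\<close>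
      then show "\<forall>\<^sub>F m in sequentially. (\<integral>\<^sup>+x. ennreal ((norm (F m x - F k x))\<^sup>2) \<partial>U) \<le> ennreal (B * (1/4) ^ k)"
        using cauchy by (auto simp: eventually_sequentially intro!: exI[of _ k] ennreal_leI)
    qed
    finally show ?thesis by (simp add: Liminf_const)
  qed
  have L2d: "(\<lambda>x. p x - F k x) \<in> L2" for k
  proof -
    have "integrable U (\<lambda>x. (norm (p x - F k x))\<^sup>2)"
      using le_less_trans[OF fatou[of k], of \<infinity>] by (intro integrableI_nonneg) auto
    then show ?thesis by (simp add: L2_def)
  qed
  show ?thesis
  proof
    show "p \<in> L2"
      using L2_add[OF L2d F, of 0 0] by simp
    fix k
    \<comment> \<open>\<open>ennreal\<close> sends negative numbers to 0, so the real inequality can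
      be read off only for a nonnegative bound; the case \<open>m = k\<close> of the Cauchy bound
      supplies that.\<close>
    have "0 \<le> B * (1/4) ^ k"
      using cauchy[of k k] nsq_nonneg[of "\<lambda>x. F k x - F k x"] by linarith
    moreover have "ennreal (nsq (\<lambda>x. p x - F k x)) \<le> ennreal (B * (1/4) ^ k)"
      using fatou[of k] nn_integral_eq_integral[OF L2_square_integrable[OF L2d[of k]]]
      by (simp add: nsq_def)
    ultimately show "nsq (\<lambda>x. p x - F k x) \<le> B * (1/4) ^ k"
      by (simp add: ennreal_le_iff)
  qed
qed

text \<open>The direct method: \<open>nsq f - 2 * Re (L f)\<close> is bounded below, the
  parallelogram law makes a minimising sequence Cauchy, and the first variation vanishes in the
  limit. The bound is on squares, to match \<open>antidual\<close>.\<close>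

lemma riesz_representation_L2:
  assumes add: "\<And>f g. f \<in> L2 \<Longrightarrow> g \<in> L2 \<Longrightarrow> L (\<lambda>x. f x + g x) = L f + L g"
    and cmult: "\<And>f c. f \<in> L2 \<Longrightarrow> L (\<lambda>x. c * f x) = cnj c * L f"
    and bound: "\<And>f. f \<in> L2 \<Longrightarrow> (norm (L f))\<^sup>2 \<le> C * nsq f"
  obtains p where "p \<in> L2" "\<And>f. f \<in> L2 \<Longrightarrow> L f = form_a p f"
proof -
  define J where "J f = nsq f - 2 * Re (L f)" for f
  have J_lower: "- (\<bar>C\<bar> + 1) \<le> J f" if f: "f \<in> L2" for f
  proof -
    \<comment> \<open>\<open>C\<close> may be zero or negative; the positive \<open>D\<close> can be
      cancelled after completing the square.\<close>
    define D where "D = \<bar>C\<bar> + 1"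
    have D: "D > 0" by (simp add: D_def)
    have "(norm (L f))\<^sup>2 \<le> D * nsq f"
      using bound[OF f] mult_right_mono[OF _ nsq_nonneg, of C D f] abs_ge_self[of C]
      unfolding D_def by linarith
    moreover have "0 \<le> (norm (L f) - D)\<^sup>2" by simp
    ultimately have "D * (2 * norm (L f)) \<le> D * (nsq f + D)"
      by (simp add: power2_eq_square algebra_simps)
    then have "2 * norm (L f) \<le> nsq f + D" using D by simp
    then show ?thesis using complex_Re_le_cmod[of "L f"] by (simp add: J_def D_def)
  qed
  define I where "I = (INF f\<in>L2. J f)"
  have bdd: "bdd_below (J ` L2)" using J_lower by (auto intro!: bdd_belowI2)
  have I_le: "I \<le> J f" if "f \<in> L2" for f
    unfolding I_def using bdd that by (rule cINF_lower)
  have "\<exists>f\<in>L2. J f < I + (1/4) ^ k" for k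
    unfolding I_def using L2_const by (intro iffD1[OF cINF_less_iff[OF _ bdd]]) (auto simp: I_def)
  then obtain F where F: "\<And>k. F k \<in> L2" "\<And>k. J (F k) < I + (1/4) ^ k"
    by metis
  have "nsq (\<lambda>x. F m x - F k x) \<le> 4 * (1/4) ^ k" if "k \<le> m" for k m
  proof -
    \<comment> \<open>The value of \<open>J\<close> at the midpoint is still at least the infimum;
      with the parallelogram law this bounds the distance of two near-minimisers.\<close>
    define h where "h = (\<lambda>x. (1/2) * (F m x + F k x))"
    have "I \<le> J h"
      unfolding h_def using F by (intro I_le L2_cmult L2_add)
    moreover have "4 * nsq h = nsq (\<lambda>x. F m x + F k x)"
      unfolding h_def by (subst nsq_cmult) (simp add: power2_eq_square)
    moreover have "2 * Re (L h) = Re (L (F m)) + Re (L (F k))"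
      unfolding h_def using F by (subst cmult) (auto simp: add L2_add)
    ultimately have "4 * I \<le> nsq (\<lambda>x. F m x + F k x) - 2 * (Re (L (F m)) + Re (L (F k))) * 2"
      by (simp add: J_def)
    also have "\<dots> = nsq (\<lambda>x. F m x + F k x) - 4 * Re (L (F m)) - 4 * Re (L (F k))"
      by simp
    also have "\<dots> = 2 * J (F m) + 2 * J (F k) - nsq (\<lambda>x. F m x - F k x)"
      using nsq_parallelogram[of "F m" "F k"] F by (simp add: J_def)
    finally have "nsq (\<lambda>x. F m x - F k x) \<le> 2 * (1/4) ^ m + 2 * (1/4) ^ k"
      using F(2)[of m] F(2)[of k] by simp
    also have "(1/4::real) ^ m \<le> (1/4) ^ k"
      using that by (intro power_decreasing) auto
    finally show ?thesis by simp
  qed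
  then obtain p where p: "p \<in> L2" "\<And>k. nsq (\<lambda>x. p x - F k x) \<le> 4 * (1/4) ^ k"
    using L2_rapidly_Cauchy_limit[where F = F and B = 4, OF F(1)] by metis
  have half: "((1/2::real) ^ k)\<^sup>2 = (1/4) ^ k" for k
    using power_mult_distrib[of "1/2::real" "1/2" k] by (simp add: power2_eq_square)
  have Re_eq: "Re (L f) = Re (form_a p f)" if f: "f \<in> L2" for f
  proof -
    \<comment> \<open>The variation is taken at \<open>F k\<close>, which minimises \<open>J\<close>
      only up to \<open>(1/4)^k\<close>. Steps \<open>t\<close> of size \<open>(1/2)^k\<close>, with
      both signs, balance this defect against the quadratic term.\<close>
    have near: "\<bar>Re (form_a (F k) f) - Re (L f)\<bar> \<le> (1 + nsq f) * (1/2) ^ k" for k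
    proof -
      have t: "- ((1/4) ^ k) \<le> 2 * t * (Re (form_a (F k) f) - Re (L f)) + t\<^sup>2 * nsq f" for t
      proof -
        have "I \<le> J (\<lambda>x. F k x + complex_of_real t * f x)"
          using F f by (intro I_le L2_add L2_cmult)
        also have "\<dots> = J (F k) + 2 * t * (Re (form_a (F k) f) - Re (L f)) + t\<^sup>2 * nsq f"
          using F f by (simp add: J_def nsq_add_cmult add cmult L2_cmult algebra_simps)
        finally show ?thesis using F(2)[of k] by simp
      qed
      define s where "s = (1/2::real) ^ k"
      define a where "a = Re (form_a (F k) f) - Re (L f)"
      have s: "s > 0" "(1/4) ^ k = s\<^sup>2" using half by (simp_all add: s_def)
      have "s * (2 * a) \<le> s * (s * (1 + nsq f))" "s * (- 2 * a) \<le> s * (s * (1 + nsq f))"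
        using t[of s] t[of "- s"] unfolding s(2) a_def[symmetric]
        by (simp_all add: power2_eq_square algebra_simps)
      then have "2 * a \<le> s * (1 + nsq f)" "- 2 * a \<le> s * (1 + nsq f)"
        using s(1) by (simp_all only: mult_le_cancel_left_pos)
      moreover have "0 \<le> s * (1 + nsq f)" using s nsq_nonneg[of f] by simp
      ultimately show ?thesis unfolding a_def[symmetric] s_def[symmetric] by (simp add: mult.commute)
    qed
    have close: "norm (form_a p f - form_a (F k) f) \<le> 2 * sqrt (nsq f) * (1/2) ^ k" for k
    proof -
      have "(norm (form_a p f - form_a (F k) f))\<^sup>2 \<le> nsq (\<lambda>x. p x - F k x) * nsq f"
        using cauchy_schwarz_L2[of "\<lambda>x. p x - F k x" f] p F f by (simp add: form_a_diff_left L2_diff)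
      also have "\<dots> \<le> 4 * (1/4) ^ k * nsq f"
        by (intro mult_right_mono p nsq_nonneg)
      also have "\<dots> = (2 * sqrt (nsq f) * (1/2) ^ k)\<^sup>2"
        by (simp add: power_mult_distrib half nsq_nonneg)
      finally show ?thesis
        by (rule power2_le_imp_le) (simp add: nsq_nonneg)
    qed
    define K where "K = (1 + nsq f) + 2 * sqrt (nsq f)"
    have "\<bar>Re (L f) - Re (form_a p f)\<bar> \<le> K * (1/2) ^ k" for k
      using near[of k] close[of k] abs_Re_le_cmod[of "form_a p f - form_a (F k) f"]
      by (simp add: K_def algebra_simps)
    moreover have "(\<lambda>k. K * (1/2::real) ^ k) \<longlonglongrightarrow> 0"
      by (rule summable_LIMSEQ_zero[OF summable_half_power])
    ultimately have "\<bar>Re (L f) - Re (form_a p f)\<bar> \<le> 0"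
      by (intro LIMSEQ_le_const) auto
    then show ?thesis by simp
  qed
  show ?thesis
  proof
    show "p \<in> L2" by fact
    fix f assume f: "f \<in> L2"
    \<comment> \<open>By antilinearity the real part at \<open>\<i> * f\<close> is the imaginary
      part at \<open>f\<close>.\<close>
    have "Im (L f) = Im (form_a p f)"
      using Re_eq[OF L2_cmult[OF f, of \<i>]] by (simp add: cmult f form_a_cmult_right)
    with Re_eq[OF f] show "L f = form_a p f" by (simp add: complex_eq_iff)
  qed
qed

section \<open>Primitives and weak derivatives\<close>

lemma integrable_subinterval_U:
  "f \<in> L2 \<Longrightarrow> 0 \<le> a \<Longrightarrow> b \<le> 1 \<Longrightarrow> integrable (lebesgue_on {a..b}) f"
  using integrable_subinterval[OF L2_integrable, of f a b] by auto

text \<open>Moving the cutoff into the integrand puts all primitives on the fixed measure space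
  \<open>U\<close>, as Fubini and almost everywhere arguments require.\<close>

lemma prim_eq:
  assumes "x \<in> {0..1}"
  shows "prim f x = (\<integral>y. (if y \<le> x then f y else 0) \<partial>U)"
proof -
  have "prim f x = (\<integral>y. (if y \<in> {0..x} then f y else 0) \<partial>U)"
    unfolding prim_def using assms by (intro integral_restrict[symmetric]) auto
  also have "\<dots> = (\<integral>y. (if y \<le> x then f y else 0) \<partial>U)"
    by (intro Bochner_Integration.integral_cong) auto
  finally show ?thesis .
qed

lemma tail_eq:
  assumes "x \<in> {0..1}"
  shows "integral\<^sup>L (lebesgue_on {x..1}) f = (\<integral>y. (if x \<le> y then (f y :: complex) else 0) \<partial>U)"
proof -
  have "integral\<^sup>L (lebesgue_on {x..1}) f = (\<integral>y. (if y \<in> {x..1} then f y else 0) \<partial>U)"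
    using assms by (intro integral_restrict[symmetric]) auto
  also have "\<dots> = (\<integral>y. (if x \<le> y then f y else 0) \<partial>U)"
    by (intro Bochner_Integration.integral_cong) auto
  finally show ?thesis .
qed

lemma tail_eq_diff_prim:
  assumes "f \<in> L2" "x \<in> {0..1}"
  shows "integral\<^sup>L (lebesgue_on {x..1}) f = mu 0 f - prim f x"
  using integral_combine[OF L2_integrable[OF assms(1)], of x] assms(2)
  by (simp add: mu_0 prim_def)

lemma prim_0 [simp]: "prim f 0 = 0"
proof -
  have "{0::real} \<in> null_sets lebesgue" by simp
  then show ?thesis
    unfolding prim_def by (simp add: integral_eq_zero_null_sets)
qed

lemma prim_1 [simp]: "prim f 1 = mu 0 f"
  by (simp add: prim_def mu_0)

lemma prim_continuous: "f \<in> L2 \<Longrightarrow> continuous_on {0..1} (prim f)"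
  unfolding prim_def[abs_def] by (rule indefinite_integral_continuous_real[OF L2_integrable])

lemma L2_prim: "f \<in> L2 \<Longrightarrow> prim f \<in> L2"
  by (rule L2_continuous[OF prim_continuous])

lemma prim_add:
  "f \<in> L2 \<Longrightarrow> g \<in> L2 \<Longrightarrow> x \<in> {0..1} \<Longrightarrow> prim (\<lambda>x. f x + g x) x = prim f x + prim g x"
  by (simp add: prim_def integrable_subinterval_U)

lemma prim_diff:
  "f \<in> L2 \<Longrightarrow> g \<in> L2 \<Longrightarrow> x \<in> {0..1} \<Longrightarrow> prim (\<lambda>x. f x - g x) x = prim f x - prim g x"
  by (simp add: prim_def integrable_subinterval_U)

lemma prim_cmult: "prim (\<lambda>x. c * f x) x = c * prim f x"
  by (simp add: prim_def)

lemma prim_cong_AE: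
  assumes f: "f \<in> L2" and eq: "AE x in U. g x = f x" and x: "x \<in> {0..1}"
  shows "prim g x = prim f x"
proof -
  have [measurable]: "f \<in> borel_measurable U" "g \<in> borel_measurable U"
    using L2_measurable L2_AE_eq[OF f eq] f by auto
  have [measurable]: "(\<lambda>y::real. y) \<in> borel_measurable U"
    using id_borel_measurable_lebesgue_on[of "{0..1}"] by (simp add: id_def)
  show ?thesis unfolding prim_eq[OF x]
    by (rule integral_cong_AE) (measurable, use eq in \<open>auto elim: eventually_mono\<close>)
qed

text \<open>Fubini on the triangle \<open>x <= y\<close> of the unit square; the kernel is dominated
  by the product of two integrable functions.\<close>

lemma integral_tail_mult:
  assumes f: "f \<in> L2" and h: "h \<in> L2"
  shows "(\<integral>x. integral\<^sup>L (lebesgue_on {x..1}) f * h x \<partial>U) = (\<integral>y. f y * prim h y \<partial>U)"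
proof -
  interpret pair_sigma_finite U U ..
  have [measurable]: "f \<in> borel_measurable U" "h \<in> borel_measurable U"
    using f h L2_measurable by auto
  have [measurable]: "(\<lambda>x::real. x) \<in> borel_measurable U"
    using id_borel_measurable_lebesgue_on[of "{0..1}"] by (simp add: id_def)
  define K where "K = (\<lambda>x y. if x \<le> y then f y * h x else 0)"
  have K[measurable]: "case_prod K \<in> borel_measurable (U \<Otimes>\<^sub>M U)"
    unfolding K_def by measurable
  have int: "integrable U (K x)" for x
    by (rule Bochner_Integration.integrable_bound[of U "\<lambda>y. f y * h x"])
       (use f in \<open>auto simp: K_def L2_integrable\<close>)
  have "integrable (U \<Otimes>\<^sub>M U) (case_prod K)"
  proof (rule Fubini_integrable)
    show "integrable U (\<lambda>x. \<integral>y. norm (case_prod K (x, y)) \<partial>U)"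
    proof (rule Bochner_Integration.integrable_bound)
      show "integrable U (\<lambda>x. (\<integral>y. norm (f y) \<partial>U) * norm (h x))"
        using h by (simp add: L2_integrable)
      have "(\<integral>y. norm (K x y) \<partial>U) \<le> (\<integral>y. norm (f y) \<partial>U) * norm (h x)" for x
      proof -
        have "(\<integral>y. norm (K x y) \<partial>U) \<le> (\<integral>y. norm (f y) * norm (h x) \<partial>U)"
          using int f by (intro integral_mono) (auto simp: K_def norm_mult L2_integrable)
        then show ?thesis by simp
      qed
      then show "AE x in U. norm (\<integral>y. norm (case_prod K (x, y)) \<partial>U) \<le> norm ((\<integral>y. norm (f y) \<partial>U) * norm (h x))"
        by simp
    qed measurable
  qed (use int in auto)
  from Fubini_integral[OF this]
  have "(\<integral>y. (\<integral>x. K x y \<partial>U) \<partial>U) = (\<integral>x. (\<integral>y. K x y \<partial>U) \<partial>U)" .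
  also have "(\<integral>y. (\<integral>x. K x y \<partial>U) \<partial>U) = (\<integral>y. f y * prim h y \<partial>U)"
  proof (rule Bochner_Integration.integral_cong)
    fix y assume "y \<in> space U"
    then have "f y * prim h y = (\<integral>x. f y * (if x \<le> y then h x else 0) \<partial>U)"
      by (simp add: prim_eq)
    also have "\<dots> = (\<integral>x. K x y \<partial>U)"
      by (intro Bochner_Integration.integral_cong) (auto simp: K_def)
    finally show "(\<integral>x. K x y \<partial>U) = f y * prim h y" ..
  qed simp
  also have "(\<integral>x. (\<integral>y. K x y \<partial>U) \<partial>U) = (\<integral>x. integral\<^sup>L (lebesgue_on {x..1}) f * h x \<partial>U)"
  proof (rule Bochner_Integration.integral_cong)
    fix x assume "x \<in> space U"
    then have "integral\<^sup>L (lebesgue_on {x..1}) f * h x = (\<integral>y. (if x \<le> y then f y else 0) * h x \<partial>U)"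
      by (subst tail_eq) simp_all
    also have "\<dots> = (\<integral>y. K x y \<partial>U)"
      by (intro Bochner_Integration.integral_cong) (auto simp: K_def)
    finally show "(\<integral>y. K x y \<partial>U) = integral\<^sup>L (lebesgue_on {x..1}) f * h x" ..
  qed simp
  finally show ?thesis ..
qed

lemma prim_cnj: "prim (\<lambda>x. cnj (f x)) x = cnj (prim f x)"
  by (simp add: prim_def)

text \<open>The tail integral of \<open>f\<close> is \<open>mu 0 f - prim f\<close>, so exchanging
  the order of integration produces the boundary term.\<close>

lemma integral_by_parts_prim:
  assumes f: "f \<in> L2" and h: "h \<in> L2"
  shows "form_a (prim f) h = mu 0 f * cnj (mu 0 h) - form_a f (prim h)"
proof -
  have "form_a f (prim h) = (\<integral>y. f y * prim (\<lambda>x. cnj (h x)) y \<partial>U)"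
    by (simp add: form_a_def int01_def prim_cnj)
  also have "\<dots> = (\<integral>x. integral\<^sup>L (lebesgue_on {x..1}) f * cnj (h x) \<partial>U)"
    by (rule integral_tail_mult[symmetric]) (use f h L2_cnj in auto)
  also have "\<dots> = form_a (\<lambda>x. mu 0 f * 1 - prim f x) h"
    unfolding form_a_def int01_def
    by (intro Bochner_Integration.integral_cong) (auto simp: tail_eq_diff_prim[OF f])
  also have "\<dots> = mu 0 f * form_a (\<lambda>x. 1) h - form_a (prim f) h"
    by (subst form_a_diff_left) (simp_all add: f h L2_prim L2_const form_a_cmult_left del: mult_1_right)
  also have "form_a (\<lambda>x. 1) h = cnj (mu 0 h)"
    unfolding mu_eq_form_a pw_0 by (rule form_a_commute)
  finally show ?thesis by (simp add: algebra_simps)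
qed

lemma prim_pw:
  assumes "x \<in> {0..1}"
  shows "prim (pw k) x = (1 - pw (Suc k) x) / of_nat (Suc k)"
proof -
  have "((\<lambda>y. pw k y) has_integral (- pw (Suc k) x / of_nat (Suc k) - (- pw (Suc k) 0 / of_nat (Suc k)))) {0..x}"
  proof (rule fundamental_theorem_of_calculus)
    show "0 \<le> x" using assms by simp
    fix y
    have "((\<lambda>y::real. - ((1 - y) ^ Suc k) / real (Suc k)) has_real_derivative (1 - y) ^ k) (at y within {0..x})"
      by (rule derivative_eq_intros refl | simp)+
    then have "((\<lambda>y::real. complex_of_real (- ((1 - y) ^ Suc k) / real (Suc k))) has_vector_derivative complex_of_real ((1 - y) ^ k)) (at y within {0..x})"
      by (rule has_vector_derivative_of_real)
    then show "((\<lambda>x. - pw (Suc k) x / of_nat (Suc k)) has_vector_derivative pw k y) (at y within {0..x})"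
      by (simp add: pw_def)
  qed
  moreover have "(pw k has_integral prim (pw k) x) {0..x}"
    unfolding prim_def using assms
    by (intro has_integral_integral_lebesgue_on integrable_subinterval_U L2_pw) auto
  ultimately have "prim (pw k) x = - pw (Suc k) x / of_nat (Suc k) - (- pw (Suc k) 0 / of_nat (Suc k))"
    using has_integral_unique by blast
  then show ?thesis by (simp add: pw_def diff_divide_distrib)
qed

lemma pw_1 [simp]: "pw k 1 = (if k = 0 then 1 else 0)" "pw k 0 = 1"
  by (auto simp: pw_def)

lemma mu_0_pw: "mu 0 (pw k) = 1 / of_nat (Suc k)"
  using prim_pw[of 1 k] by simp

section \<open>Weak derivatives\<close>

lemma is_wderiv_iff: "is_wderiv u g \<longleftrightarrow> g \<in> L2 \<and> (\<forall>x\<in>{0..1}. prim g x = u x - u 0)"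
  unfolding is_wderiv_def prim_def by (metis add_diff_cancel_left' diff_add_cancel add.commute)

lemma is_wderiv_L2: "is_wderiv u g \<Longrightarrow> g \<in> L2"
  by (simp add: is_wderiv_iff)

lemma is_wderiv_eq: "is_wderiv u g \<Longrightarrow> x \<in> {0..1} \<Longrightarrow> prim g x = u x - u 0"
  by (simp add: is_wderiv_iff)

lemma is_wderiv_fun_L2: "is_wderiv u g \<Longrightarrow> u \<in> L2"
  using L2_cong[OF L2_add[OF L2_const L2_prim[OF is_wderiv_L2]], of u g "u 0" u]
  by (simp add: is_wderiv_eq[of u])

lemma wderiv_is_wderiv: "u \<in> H1 \<Longrightarrow> is_wderiv u (wderiv u)"
  unfolding H1_def wderiv_def by (auto intro: someI[of "is_wderiv u"])

lemma H1_L2: "u \<in> H1 \<Longrightarrow> u \<in> L2"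
  using is_wderiv_fun_L2 wderiv_is_wderiv by blast

lemma is_wderiv_const: "is_wderiv (\<lambda>x. c) (\<lambda>x. 0)"
  by (simp add: is_wderiv_iff L2_const prim_def)

lemma is_wderiv_add:
  assumes "is_wderiv u g" "is_wderiv v h"
  shows "is_wderiv (\<lambda>x. u x + v x) (\<lambda>x. g x + h x)"
proof -
  note L = is_wderiv_L2[OF assms(1)] is_wderiv_L2[OF assms(2)]
  show ?thesis unfolding is_wderiv_iff
    using is_wderiv_eq[OF assms(1)] is_wderiv_eq[OF assms(2)] L
    by (simp add: L2_add prim_add)
qed

lemma is_wderiv_cmult: "is_wderiv u g \<Longrightarrow> is_wderiv (\<lambda>x. c * u x) (\<lambda>x. c * g x)"
  unfolding is_wderiv_iff prim_cmult by (simp add: L2_cmult right_diff_distrib)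

lemma is_wderiv_cong:
  assumes "is_wderiv u g" "\<And>x. x \<in> {0..1} \<Longrightarrow> v x = u x"
  shows "is_wderiv v g"
  using assms by (simp add: is_wderiv_iff)

lemma is_wderiv_prim: "g \<in> L2 \<Longrightarrow> is_wderiv (prim g) g"
  by (simp add: is_wderiv_iff)

lemma is_wderiv_pw: "is_wderiv (pw (Suc k)) (\<lambda>x. - of_nat (Suc k) * pw k x)"
proof -
  have "- of_nat (Suc k) * prim (pw k) x = pw (Suc k) x - 1" if "x \<in> {0..1}" for x
    using prim_pw[OF that, of k] by (simp del: of_nat_Suc)
  then show ?thesis
    unfolding is_wderiv_iff prim_cmult using L2_cmult[OF L2_pw] by simp
qed

text \<open>Integration by parts: \<open>pw (Suc k)\<close> vanishes at 1, so only the boundary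
  value at 0 survives. This is the source of the term \<open>f 0\<close> in
  \<open>gamma\<close>.\<close>

lemma form_a_wderiv_pw:
  assumes "is_wderiv u g"
  shows "form_a g (pw (Suc k)) = of_nat (Suc k) * form_a u (pw k) - u 0"
proof -
  note g = is_wderiv_L2[OF assms]
  define N :: complex where "N = of_nat (Suc k)"
  have N: "N \<noteq> 0" "cnj N = N" by (simp_all add: N_def del: of_nat_Suc)
  have "form_a g (pw (Suc k)) = form_a g (\<lambda>x. pw 0 x - N * prim (pw k) x)"
    using N by (intro form_a_cong) (auto simp: prim_pw pw_0 N_def[symmetric] simp del: of_nat_Suc)
  also have "\<dots> = mu 0 g - N * form_a g (prim (pw k))"
    using g N by (simp add: form_a_diff_right form_a_cmult_right L2_pw L2_prim L2_cmult mu_eq_form_a)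
  also have "form_a g (prim (pw k)) = mu 0 g / N - form_a (prim g) (pw k)"
    using integral_by_parts_prim[OF g L2_pw, of k] N
    by (simp add: mu_0_pw N_def[symmetric] del: of_nat_Suc)
  also have "form_a (prim g) (pw k) = form_a (\<lambda>x. u x - u 0 * pw 0 x) (pw k)"
    by (intro form_a_cong) (auto simp: is_wderiv_eq[OF assms] pw_0)
  also have "\<dots> = form_a u (pw k) - u 0 * cnj (mu 0 (pw k))"
    using is_wderiv_fun_L2[OF assms] unfolding mu_eq_form_a form_a_commute[of "pw 0", symmetric]
    by (simp add: form_a_diff_left L2_pw L2_cmult form_a_cmult_left)
  finally have "N * form_a g (pw (Suc k)) = N * (N * form_a u (pw k) - u 0)" using N
    by (simp add: mu_0_pw N_def[symmetric] field_simps del: of_nat_Suc)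
  then show ?thesis using N by (simp add: N_def)
qed

text \<open>Lebesgue differentiation: the averages over \<open>[x, x + h]\<close> vanish together
  with the primitive, and they converge to the function almost everywhere.\<close>

lemma prim_zero_imp_AE_zero:
  assumes d: "d \<in> L2" and zero: "\<And>x. x \<in> {0..1} \<Longrightarrow> prim d x = 0"
  shows "AE x in U. d x = 0"
proof -
  \<comment> \<open>Extension by zero, since the differentiation theorem is applied to a function
    integrable on every box.\<close>
  define f where "f = (\<lambda>x. if x \<in> {0..1} then d x else 0)"
  have "integrable lebesgue f"
    unfolding f_def by (rule iffD2[OF Lebesgue_Measure.integrable_restrict_UNIV]) (auto simp: L2_integrable[OF d])
  then have "f integrable_on UNIV"
    using integrable_on_lebesgue_on[of UNIV f] by (simp add: lebesgue_on_UNIV_eq)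
  then have f_int: "f integrable_on cbox a b" for a b
    by (rule integrable_on_subcbox) simp
  obtain N where N: "negligible N" and
    lim: "\<And>x e. \<lbrakk>x \<notin> N; 0 < e\<rbrakk> \<Longrightarrow> \<exists>\<delta>>0. \<forall>h. 0 < h \<and> h < \<delta> \<longrightarrow>
       norm (integral (cbox x (x + h *\<^sub>R One)) f /\<^sub>R h ^ DIM(real) - f x) < e"
    using integrable_ccontinuous_explicit[OF f_int] by metis
  have HK: "integral {0..x} d = 0" if "x \<in> {0..1}" for x
    using zero[OF that] that lebesgue_integral_eq_integral[of "{0..x}" d]
      integrable_subinterval_U[OF d, of 0 x]
    by (simp add: prim_def)
  have d_int: "d integrable_on {0..y}" if "y \<in> {0..1}" for y
    using that integrable_on_lebesgue_on[OF integrable_subinterval_U[OF d, of 0 y]] by simp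
  have seg: "integral {x..y} f = 0" if "0 \<le> x" "x \<le> y" "y \<le> 1" for x y
  proof -
    have "integral {x..y} f = integral {x..y} d"
      using that by (intro Henstock_Kurzweil_Integration.integral_cong) (auto simp: f_def)
    moreover have "integral {0..x} d + integral {x..y} d = integral {0..y} d"
      using that d_int by (intro Henstock_Kurzweil_Integration.integral_combine) auto
    ultimately show ?thesis using HK that by simp
  qed
  \<comment> \<open>The point 1 joins the exceptional set: averages to the right of \<open>x\<close>
    stay inside the unit interval only if \<open>x < 1\<close>.\<close>
  have zero_off: "d x = 0" if x: "x \<in> {0..1}" "x \<notin> insert 1 N" for x
  proof (rule ccontr)
    assume "d x \<noteq> 0"
    then obtain \<delta> where \<delta>: "\<delta> > 0" "\<And>h. 0 < h \<Longrightarrow> h < \<delta> \<Longrightarrow>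
       norm (integral {x..x + h} f /\<^sub>R h - f x) < norm (d x)"
      using lim[of x "norm (d x)"] x by auto
    define h where "h = min (\<delta> / 2) (1 - x)"
    have h: "0 < h" "h < \<delta>" "x + h \<le> 1" using x \<delta>(1) by (auto simp: h_def)
    show False using \<delta>(2)[OF h(1,2)] seg[of x "x + h"] h x by (simp add: f_def)
  qed
  have "insert 1 N \<in> null_sets lebesgue"
    using N by (simp add: negligible_iff_null_sets[symmetric])
  then have "AE x in lebesgue. x \<notin> insert 1 N"
    by (rule AE_not_in)
  then have "AE x in lebesgue. x \<in> {0..1} \<longrightarrow> d x = 0"
    by (rule eventually_mono) (use zero_off in blast)
  then show ?thesis
    by (subst AE_restrict_space_iff) auto
qed

lemma is_wderiv_unique:
  assumes "is_wderiv u g" "is_wderiv u h"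
  shows "AE x in U. g x = h x"
proof -
  have "AE x in U. g x - h x = 0"
  proof (rule prim_zero_imp_AE_zero)
    fix x :: real assume "x \<in> {0..1}"
    then show "prim (\<lambda>x. g x - h x) x = 0"
      using assms by (simp add: prim_diff is_wderiv_L2 is_wderiv_eq[of u])
  qed (use assms in \<open>auto intro: L2_diff is_wderiv_L2\<close>)
  then show ?thesis by simp
qed

text \<open>Makes the choice in \<open>wderiv\<close> harmless: any weak derivative at hand may
  replace it under an integral.\<close>

lemma wderiv_AE_eq: "is_wderiv u g \<Longrightarrow> AE x in U. wderiv u x = g x"
  by (rule is_wderiv_unique[OF wderiv_is_wderiv]) (auto simp: H1_def)

section \<open>The operators Jn and Pn\<close>

lemma Jn_eq:
  assumes "\<phi> \<in> L2" "x \<in> {0..1}"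
  shows "Jn n \<phi> x = mu 0 \<phi> * (1 - pw n x) - prim \<phi> x"
  unfolding Jn_def tail_eq_diff_prim[OF assms] pw_def by (simp add: algebra_simps)

text \<open>The index is a successor, so that the derivative of \<open>(1 - x)^n\<close> carries the
  power \<open>m = n - 1\<close> without truncated subtraction.\<close>

lemma is_wderiv_Jn:
  assumes \<phi>: "\<phi> \<in> L2"
  shows "is_wderiv (Jn (Suc m) \<phi>) (\<lambda>x. (of_nat (Suc m) * mu 0 \<phi>) * pw m x - \<phi> x)"
proof -
  have "is_wderiv (\<lambda>x. (mu 0 \<phi> + - mu 0 \<phi> * pw (Suc m) x) + - 1 * prim \<phi> x)
     (\<lambda>x. (0 + - mu 0 \<phi> * (- of_nat (Suc m) * pw m x)) + - 1 * \<phi> x)"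
    by (intro is_wderiv_add is_wderiv_cmult is_wderiv_const is_wderiv_pw is_wderiv_prim \<phi>)
  moreover have "(\<lambda>x. (0 + - mu 0 \<phi> * (- of_nat (Suc m) * pw m x)) + - 1 * \<phi> x)
     = (\<lambda>x. (of_nat (Suc m) * mu 0 \<phi>) * pw m x - \<phi> x)"
    by (simp add: fun_eq_iff mult_ac del: of_nat_Suc)
  ultimately have "is_wderiv (\<lambda>x. (mu 0 \<phi> + - mu 0 \<phi> * pw (Suc m) x) + - 1 * prim \<phi> x)
     (\<lambda>x. (of_nat (Suc m) * mu 0 \<phi>) * pw m x - \<phi> x)"
    by simp
  then show ?thesis
    by (rule is_wderiv_cong) (simp add: Jn_eq[OF \<phi>] right_diff_distrib)
qed

text \<open>At 0 the correction \<open>mu 0 \<phi> * (1 - x)^n\<close> cancels the whole integral;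
  at 1 it vanishes because \<open>n\<close> is positive.\<close>

lemma Jn_boundary:
  assumes "\<phi> \<in> L2" "n \<ge> 1"
  shows "Jn n \<phi> 0 = 0" "Jn n \<phi> 1 = 0"
  using assms by (simp_all add: Jn_eq)

lemma Jn_H1:
  assumes "\<phi> \<in> L2" "n \<ge> 1"
  shows "Jn n \<phi> \<in> H1"
  using is_wderiv_Jn[OF assms(1), of "n - 1"] assms(2) by (auto simp: H1_def)

lemma Jn_H1T: "\<phi> \<in> L2 \<Longrightarrow> n \<ge> 1 \<Longrightarrow> Jn n \<phi> \<in> H1T"
  by (simp add: H1T_def Jn_H1 Jn_boundary)

lemma form_a_const_right: "form_a f (\<lambda>x. c) = cnj c * mu 0 f"
  using form_a_cmult_right[of f c "pw 0"] by (simp add: mu_eq_form_a pw_0)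

lemma form_a_const_left: "form_a (\<lambda>x. c) f = c * cnj (mu 0 f)"
  using form_a_cmult_left[of c "pw 0" f] form_a_commute[of "pw 0" f]
  by (simp add: mu_eq_form_a pw_0)

lemma form_a_pw_left: "form_a (pw k) f = cnj (mu k f)"
  unfolding mu_eq_form_a by (rule form_a_commute)

lemma mu_add: "f \<in> L2 \<Longrightarrow> g \<in> L2 \<Longrightarrow> mu k (\<lambda>x. f x + g x) = mu k f + mu k g"
  by (simp add: mu_eq_form_a form_a_add_left L2_pw)

lemma mu_diff: "f \<in> L2 \<Longrightarrow> g \<in> L2 \<Longrightarrow> mu k (\<lambda>x. f x - g x) = mu k f - mu k g"
  by (simp add: mu_eq_form_a form_a_diff_left L2_pw)

lemma mu_cmult: "mu k (\<lambda>x. c * f x) = c * mu k f"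
  by (simp add: mu_eq_form_a form_a_cmult_left)

lemma mu_pw: "mu j (pw k) = 1 / of_nat (Suc (j + k))"
proof -
  have "mu j (pw k) = mu 0 (pw (j + k))"
    by (simp add: mu_def pw_def power_add)
  then show ?thesis by (simp add: mu_0_pw)
qed

lemma mu_const: "mu k (\<lambda>x. c) = c / of_nat (Suc k)"
  using mu_cmult[of k c "pw 0"] mu_pw[of k 0] by (simp add: pw_0)

text \<open>The boundary term of integration by parts cancels against the constant part of
  \<open>Jn\<close>, which leaves only the moment \<open>mu n h\<close>.\<close>

lemma form_a_Jn:
  assumes p: "p \<in> L2" and h: "h \<in> L2"
  shows "form_a (Jn n p) h = form_a p (\<lambda>x. prim h x - mu n h)"
proof -
  have "form_a (Jn n p) h = form_a (\<lambda>x. (mu 0 p - mu 0 p * pw n x) - prim p x) h"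
    using p by (intro form_a_cong) (auto simp: Jn_eq right_diff_distrib)
  also have "\<dots> = mu 0 p * cnj (mu 0 h) - mu 0 p * cnj (mu n h) - form_a (prim p) h"
    using p h by (simp add: form_a_diff_left L2_const L2_cmult L2_pw L2_diff L2_prim
        form_a_const_left form_a_cmult_left form_a_pw_left)
  also have "\<dots> = form_a p (prim h) - form_a p (\<lambda>x. mu n h)"
    by (simp add: integral_by_parts_prim[OF p h] form_a_const_right mult.commute)
  also have "\<dots> = form_a p (\<lambda>x. prim h x - mu n h)"
    using p h by (simp add: form_a_diff_right L2_const L2_prim)
  finally show ?thesis .
qed

text \<open>\<open>Pn\<close> is determined only up to null sets, whereas
  \<open>Jn n (Pn n w)\<close> is later computed at every point.\<close>

lemma Jn_cong_AE:
  assumes f: "f \<in> L2" and eq: "AE x in U. g x = f x" and x: "x \<in> {0..1}"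
  shows "Jn n g x = Jn n f x"
proof -
  have "mu 0 g = mu 0 f" using prim_cong_AE[OF f eq, of 1] by simp
  then show ?thesis
    using Jn_eq[OF f x] Jn_eq[OF L2_AE_eq[OF f eq] x] prim_cong_AE[OF f eq x] by simp
qed

section \<open>Bounds on the H^1 norm\<close>

lemma H1_normsq_eq: "H1_normsq u = nsq u + nsq (wderiv u)"
  unfolding H1_normsq_def int01_def nsq_def integral_complex_of_real by simp

lemma nsq_cong_AE:
  assumes "f \<in> L2" "AE x in U. g x = f x"
  shows "nsq g = nsq f"
proof -
  have "complex_of_real (nsq g) = complex_of_real (nsq f)"
    unfolding form_a_self[symmetric]
    by (rule form_a_cong_AE) (use assms in \<open>auto elim: eventually_mono\<close>)
  then show ?thesis by simp
qed

lemma nsq_diff_le: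
  assumes "f \<in> L2" "g \<in> L2"
  shows "nsq (\<lambda>x. f x - g x) \<le> 2 * nsq f + 2 * nsq g"
  using nsq_parallelogram[OF assms] nsq_nonneg[of "\<lambda>x. f x + g x"] by linarith

lemma nsq_le_const:
  assumes "f \<in> L2" "\<And>x. x \<in> {0..1} \<Longrightarrow> (norm (f x))\<^sup>2 \<le> c"
  shows "nsq f \<le> c"
proof -
  have "nsq f \<le> (\<integral>x. c \<partial>U)"
    unfolding nsq_def using assms by (intro integral_mono) (auto simp: L2_square_integrable)
  then show ?thesis by (simp add: measure_restrict_space)
qed

text \<open>Cauchy-Schwarz against the indicator of \<open>[0, x]\<close> gives the bound pointwise;
  integrating over an interval of length 1 keeps it.\<close>

lemma nsq_prim_le:
  assumes g: "g \<in> L2"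
  shows "nsq (prim g) \<le> nsq g"
proof (rule nsq_le_const[OF L2_prim[OF g]])
  fix x :: real assume x: "x \<in> {0..1}"
  define I :: "real \<Rightarrow> complex" where "I y = indicator {0..x} y * 1" for y
  have I: "I \<in> L2" unfolding I_def[abs_def]
    using x by (intro L2_indicator L2_const) (auto simp: sets_restrict_space_iff)
  have "prim g x = form_a g I"
    unfolding prim_eq[OF x] form_a_def int01_def
    by (intro Bochner_Integration.integral_cong) (auto simp: I_def indicator_def)
  moreover have "(norm (form_a g I))\<^sup>2 \<le> nsq g * nsq I"
    by (rule cauchy_schwarz_L2[OF g I])
  moreover have "nsq I \<le> 1"
    by (rule nsq_le_const[OF I]) (simp add: I_def indicator_def)
  then have "nsq g * nsq I \<le> nsq g * 1"
    by (intro mult_left_mono nsq_nonneg)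
  ultimately show "(norm (prim g x))\<^sup>2 \<le> nsq g" by simp
qed

text \<open>A Poincare inequality: once the value at 0 is zero, the derivative controls the full
  norm.\<close>

lemma H1_normsq_le:
  assumes u: "is_wderiv u g" and "u 0 = 0"
  shows "H1_normsq u \<le> 2 * nsq g"
proof -
  have "nsq u = nsq (prim g)"
    unfolding nsq_def
    by (intro Bochner_Integration.integral_cong) (auto simp: is_wderiv_eq[OF u] \<open>u 0 = 0\<close>)
  moreover have "nsq (wderiv u) = nsq g"
    using u by (intro nsq_cong_AE is_wderiv_L2 wderiv_AE_eq)
  ultimately show ?thesis
    using nsq_prim_le[OF is_wderiv_L2[OF u]] by (simp add: H1_normsq_eq)
qed

section \<open>Functionals on H^1(T) and their images under Pn\<close>

lemma H1_add: "u \<in> H1 \<Longrightarrow> v \<in> H1 \<Longrightarrow> (\<lambda>x. u x + v x) \<in> H1"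
  unfolding H1_def using is_wderiv_add by blast

lemma H1_cmult: "u \<in> H1 \<Longrightarrow> (\<lambda>x. c * u x) \<in> H1"
  unfolding H1_def using is_wderiv_cmult by blast

lemma H1T_add: "u \<in> H1T \<Longrightarrow> v \<in> H1T \<Longrightarrow> (\<lambda>x. u x + v x) \<in> H1T"
  by (simp add: H1T_def H1_add)

lemma H1T_cmult: "u \<in> H1T \<Longrightarrow> (\<lambda>x. c * u x) \<in> H1T"
  by (simp add: H1T_def H1_cmult)

lemma Hm1T_add:
  "F \<in> Hm1T \<Longrightarrow> \<phi> \<in> H1T \<Longrightarrow> \<psi> \<in> H1T \<Longrightarrow> F (\<lambda>x. \<phi> x + \<psi> x) = F \<phi> + F \<psi>"
  by (simp add: antidual_def)

lemma Hm1T_cmult: "F \<in> Hm1T \<Longrightarrow> \<phi> \<in> H1T \<Longrightarrow> F (\<lambda>x. c * \<phi> x) = cnj c * F \<phi>"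
  by (simp add: antidual_def)

text \<open>Functionals are HOL functions and could a priori see values off \<open>[0, 1]\<close>.
  Boundedness excludes this, because a difference vanishing on \<open>[0, 1]\<close> has zero
  norm.\<close>

lemma Hm1T_cong:
  assumes F: "F \<in> Hm1T" and "\<phi> \<in> H1T" "\<psi> \<in> H1T"
    and eq: "\<And>x. x \<in> {0..1} \<Longrightarrow> \<phi> x = \<psi> x"
  shows "F \<phi> = F \<psi>"
proof -
  define \<eta> where "\<eta> x = \<psi> x + (- 1) * \<phi> x" for x
  have \<eta>T: "\<eta> \<in> H1T" unfolding \<eta>_def[abs_def] using assms by (intro H1T_add H1T_cmult)
  obtain C where C: "\<forall>\<phi>\<in>H1T. (norm (F \<phi>))\<^sup>2 \<le> C * H1_normsq \<phi>"
    using F unfolding antidual_def by blast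
  have d: "is_wderiv \<eta> (\<lambda>x. 0)"
    by (rule is_wderiv_cong[OF is_wderiv_const[of 0]]) (simp add: \<eta>_def eq)
  have "H1_normsq \<eta> \<le> 2 * nsq (\<lambda>x. 0)"
    by (rule H1_normsq_le[OF d]) (simp add: \<eta>_def eq)
  then have "H1_normsq \<eta> = 0"
    using nsq_nonneg[of \<eta>] nsq_nonneg[of "wderiv \<eta>"] nsq_cmult[of 0 "pw 0"]
    by (simp add: H1_normsq_eq)
  then have "F \<eta> = 0" using bspec[OF C \<eta>T] by simp
  moreover have "F (\<lambda>x. \<phi> x + \<eta> x) = F \<phi> + F \<eta>"
    using Hm1T_add[OF F] assms \<eta>T by simp
  ultimately show ?thesis by (simp add: \<eta>_def)
qed

text \<open>Two representing functions differ by a function orthogonal to itself, so the choice in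
  \<open>Pn\<close> matters only on a null set.\<close>

lemma Pn_AE_eq:
  assumes p: "p \<in> L2" and rep: "\<And>\<phi>. \<phi> \<in> L2 \<Longrightarrow> F (Jn n \<phi>) = form_a p \<phi>"
  shows "Pn n F \<in> L2" "AE x in U. Pn n F x = p x"
    "\<phi> \<in> L2 \<Longrightarrow> F (Jn n \<phi>) = form_a (Pn n F) \<phi>"
proof -
  have "\<exists>p. p \<in> L2 \<and> (\<forall>\<phi>\<in>L2. F (Jn n \<phi>) = int01 (\<lambda>x. p x * cnj (\<phi> x)))"
    using p rep by (auto simp: form_a_def)
  from someI_ex[OF this]
  have P: "Pn n F \<in> L2" "\<And>\<phi>. \<phi> \<in> L2 \<Longrightarrow> F (Jn n \<phi>) = form_a (Pn n F) \<phi>"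
    unfolding Pn_def[symmetric] form_a_def by auto
  define d where "d x = Pn n F x - p x" for x
  have d: "d \<in> L2" unfolding d_def[abs_def] by (intro L2_diff P p)
  have "form_a d d = form_a (Pn n F) d - form_a p d"
    unfolding d_def[abs_def] using P p by (intro form_a_diff_left L2_diff)
  also have "\<dots> = 0" using P(2)[OF d] rep[OF d] by simp
  finally have "nsq d = 0" by (simp add: form_a_self)
  then have "AE x in U. d x = 0" by (rule nsq_eq_0_AE[OF d])
  then show "AE x in U. Pn n F x = p x" by (simp add: d_def)
  show "Pn n F \<in> L2" "\<phi> \<in> L2 \<Longrightarrow> F (Jn n \<phi>) = form_a (Pn n F) \<phi>" using P by auto
qed

text \<open>\<open>Jn\<close> is bounded from L^2 into H^1(T), so composing it with \<open>F\<close>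
  gives a bounded antilinear functional on L^2, to which Riesz representation applies.\<close>

lemma Pn_L2:
  assumes F: "F \<in> Hm1T" and n: "n \<ge> 1"
  shows "Pn n F \<in> L2"
proof -
  obtain m where m: "n = Suc m" using n by (cases n) auto
  obtain C where C: "\<forall>\<phi>\<in>H1T. (norm (F \<phi>))\<^sup>2 \<le> C * H1_normsq \<phi>"
    using F unfolding antidual_def by blast
  \<comment> \<open>The outer 2 comes from \<open>H1_normsq_le\<close>, the inner ones from
    \<open>nsq_diff_le\<close>, and \<open>nsq (pw 0)\<close> from Cauchy-Schwarz for
    \<open>mu 0\<close>.\<close>
  define K where "K = 2 * (2 * ((real n)\<^sup>2 * nsq (pw 0) * nsq (pw m)) + 2)"
  have JT: "Jn n \<phi> \<in> H1T" if "\<phi> \<in> L2" for \<phi> using Jn_H1T[OF that n] .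
  have J_le: "H1_normsq (Jn n \<phi>) \<le> K * nsq \<phi>" if \<phi>: "\<phi> \<in> L2" for \<phi>
  proof -
    have "H1_normsq (Jn n \<phi>) \<le> 2 * nsq (\<lambda>x. (of_nat n * mu 0 \<phi>) * pw m x - \<phi> x)"
      using is_wderiv_Jn[OF \<phi>, of m] Jn_boundary[OF \<phi> n] unfolding m by (intro H1_normsq_le)
    also have "nsq (\<lambda>x. (of_nat n * mu 0 \<phi>) * pw m x - \<phi> x)
        \<le> 2 * nsq (\<lambda>x. (of_nat n * mu 0 \<phi>) * pw m x) + 2 * nsq \<phi>"
      by (intro nsq_diff_le L2_cmult L2_pw \<phi>)
    also have "nsq (\<lambda>x. (of_nat n * mu 0 \<phi>) * pw m x) = (real n)\<^sup>2 * nsq (pw m) * (norm (mu 0 \<phi>))\<^sup>2"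
      unfolding nsq_cmult by (simp add: norm_mult power_mult_distrib)
    also have "\<dots> \<le> (real n)\<^sup>2 * nsq (pw m) * (nsq \<phi> * nsq (pw 0))"
      using cauchy_schwarz_L2[OF \<phi> L2_pw, of 0]
      by (intro mult_left_mono mult_nonneg_nonneg nsq_nonneg) (simp_all add: mu_eq_form_a)
    finally show ?thesis by (simp add: K_def algebra_simps)
  qed
  have "\<exists>p\<in>L2. \<forall>\<phi>\<in>L2. F (Jn n \<phi>) = form_a p \<phi>"
  proof (rule riesz_representation_L2[of "\<lambda>\<phi>. F (Jn n \<phi>)" "\<bar>C\<bar> * K"])
    fix f g assume f: "f \<in> L2" and g: "g \<in> L2"
    have "F (Jn n (\<lambda>x. f x + g x)) = F (\<lambda>x. Jn n f x + Jn n g x)"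
      using f g
      by (intro Hm1T_cong[OF F] JT H1T_add L2_add)
         (auto simp: Jn_eq L2_add mu_add prim_add algebra_simps)
    then show "F (Jn n (\<lambda>x. f x + g x)) = F (Jn n f) + F (Jn n g)"
      using Hm1T_add[OF F JT[OF f] JT[OF g]] by simp
  next
    fix f c assume f: "f \<in> L2"
    have "F (Jn n (\<lambda>x. c * f x)) = F (\<lambda>x. c * Jn n f x)"
      using f
      by (intro Hm1T_cong[OF F] JT H1T_cmult L2_cmult)
         (auto simp: Jn_eq L2_cmult mu_cmult prim_cmult algebra_simps)
    then show "F (Jn n (\<lambda>x. c * f x)) = cnj c * F (Jn n f)"
      using Hm1T_cmult[OF F JT[OF f]] by simp
  next
    fix f assume f: "f \<in> L2"
    have nn: "0 \<le> H1_normsq (Jn n f)" by (simp add: H1_normsq_eq nsq_nonneg)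
    have "(norm (F (Jn n f)))\<^sup>2 \<le> C * H1_normsq (Jn n f)" by (rule bspec[OF C JT[OF f]])
    \<comment> \<open>The constant in \<open>antidual\<close> may be negative, hence the absolute
      value before \<open>J_le\<close> is inserted.\<close>
    also have "\<dots> \<le> \<bar>C\<bar> * H1_normsq (Jn n f)" by (intro mult_right_mono nn) simp
    also have "\<dots> \<le> \<bar>C\<bar> * (K * nsq f)" by (intro mult_left_mono J_le f) simp
    finally show "(norm (F (Jn n f)))\<^sup>2 \<le> \<bar>C\<bar> * K * nsq f" by (simp add: mult.assoc)
  qed blast
  then show ?thesis using Pn_AE_eq(1) by metis
qed

lemma Pn_emb:
  assumes h: "h \<in> L2"
  shows "Pn n (emb h) \<in> L2" "AE x in U. Pn n (emb h) x = prim h x - mu n h"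
proof -
  have p: "(\<lambda>x. prim h x - mu n h) \<in> L2" by (intro L2_diff L2_prim L2_const h)
  have "emb h (Jn n \<phi>) = form_a (\<lambda>x. prim h x - mu n h) \<phi>" if "\<phi> \<in> L2" for \<phi>
  proof -
    have "emb h (Jn n \<phi>) = cnj (form_a (Jn n \<phi>) h)"
      using form_a_commute[of h "Jn n \<phi>"] by (simp add: emb_def form_a_def)
    then show ?thesis
      unfolding form_a_Jn[OF that h]
      using form_a_commute[of "\<lambda>x. prim h x - mu n h" \<phi>] by simp
  qed
  from Pn_AE_eq(1,2)[where F = "emb h", OF p this]
  show "Pn n (emb h) \<in> L2" "AE x in U. Pn n (emb h) x = prim h x - mu n h"
    by auto
qed

text \<open>Turns the defining identity of \<open>A_Y\<close> into an orthogonality relation in L^2.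
  The premise on \<open>Pn\<close> fits an abstract \<open>g\<close> as well as an explicit
  one.\<close>

lemma HY_inner_emb:
  assumes g: "Pn n g \<in> L2" and h: "h \<in> L2"
  shows "HY_inner n g (emb h) = form_a (Jn n (Pn n g)) h + mu0H g * cnj (mu 0 h)"
proof -
  have "form_a (Pn n g) (Pn n (emb h)) = form_a (Pn n g) (\<lambda>x. prim h x - mu n h)"
    using Pn_emb[OF h, of n] g
    by (intro form_a_cong_AE L2_diff L2_prim L2_const h) (auto elim: eventually_mono)
  moreover have "mu0H (emb h) = mu 0 h"
    by (simp add: mu0H_def emb_def mu_def)
  ultimately show ?thesis
    by (simp add: HY_inner_def form_a_def[symmetric] form_a_Jn[OF g h])
qed

text \<open>These are the functionals \<open>-q'\<close> in divergence form, bounded by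
  Cauchy-Schwarz. \<open>wderiv\<close> chooses afresh for sums and multiples, so antilinearity goes
  through almost everywhere equality.\<close>

lemma form_a_functional_antidual:
  assumes q: "q \<in> L2" and W: "W \<subseteq> H1"
  shows "(\<lambda>\<phi>. form_a q (wderiv \<phi>)) \<in> antidual W"
proof -
  have sum: "form_a q (wderiv (\<lambda>x. \<phi> x + \<psi> x)) = form_a q (wderiv \<phi>) + form_a q (wderiv \<psi>)"
    if "\<phi> \<in> W" "\<psi> \<in> W" for \<phi> \<psi>
  proof -
    have d: "is_wderiv \<phi> (wderiv \<phi>)" "is_wderiv \<psi> (wderiv \<psi>)"
      using that W by (auto intro: wderiv_is_wderiv)
    note L = is_wderiv_L2[OF d(1)] is_wderiv_L2[OF d(2)]
    have "form_a q (wderiv (\<lambda>x. \<phi> x + \<psi> x)) = form_a q (\<lambda>x. wderiv \<phi> x + wderiv \<psi> x)"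
      using wderiv_AE_eq[OF is_wderiv_add[OF d]] q L
      by (intro form_a_cong_AE L2_add) (auto elim: eventually_mono)
    then show ?thesis using q L by (simp add: form_a_add_right)
  qed
  have scale: "form_a q (wderiv (\<lambda>x. c * \<phi> x)) = cnj c * form_a q (wderiv \<phi>)" if "\<phi> \<in> W" for \<phi> c
  proof -
    have d: "is_wderiv \<phi> (wderiv \<phi>)"
      using that W by (auto intro: wderiv_is_wderiv)
    have "form_a q (wderiv (\<lambda>x. c * \<phi> x)) = form_a q (\<lambda>x. c * wderiv \<phi> x)"
      using wderiv_AE_eq[OF is_wderiv_cmult[OF d, of c]] q is_wderiv_L2[OF d]
      by (intro form_a_cong_AE L2_cmult) (auto elim: eventually_mono)
    then show ?thesis by (simp add: form_a_cmult_right)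
  qed
  have "(norm (form_a q (wderiv \<phi>)))\<^sup>2 \<le> nsq q * H1_normsq \<phi>" if "\<phi> \<in> W" for \<phi>
  proof -
    have "wderiv \<phi> \<in> L2"
      using that W by (auto intro: is_wderiv_L2 wderiv_is_wderiv)
    then have "(norm (form_a q (wderiv \<phi>)))\<^sup>2 \<le> nsq q * nsq (wderiv \<phi>)"
      by (rule cauchy_schwarz_L2[OF q])
    also have "\<dots> \<le> nsq q * H1_normsq \<phi>"
      by (intro mult_left_mono nsq_nonneg) (simp add: H1_normsq_eq nsq_nonneg)
    finally show ?thesis .
  qed
  with sum scale show ?thesis
    unfolding antidual_def by blast
qed

lemma rhs_dist_eq:
  "rhs_dist n u \<phi> = form_a (wderiv u) (wderiv \<phi>)
     + (if n \<ge> 2 then gamma n u * form_a (pw (n - 2)) \<phi> else 0)"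
  by (simp add: rhs_dist_def form_a_def pw_def)

text \<open>Integrating the zeroth order term by parts turns \<open>-u'' + \<gamma>(u) (1-x)^(n-2)\<close>
  into the single divergence form \<open>-q'\<close> with \<open>q = u' + \<delta> (1-x)^(n-1)\<close>, which
  extends to constants by zero and hence represents \<open>Id_m^(-1)\<close>. The choice of
  \<open>\<gamma>\<close> is exactly the one that makes \<open>q\<close> orthogonal to \<open>(1-x)^(n-1)\<close>.\<close>
lemma AY_solution:
  assumes u: "u \<in> H1" and n: "n \<ge> 1"
  obtains w where "w \<in> HY" "Idm_inv_rel (rhs_dist n u) w" "Pn n w \<in> L2"
    "\<And>x. x \<in> {0..1} \<Longrightarrow> Jn n (Pn n w) x = u x - u 1 + (u 1 - u 0) * pw n x"
proof -
  obtain m where m: "n = Suc m" using n by (cases n) auto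
  note du = wderiv_is_wderiv[OF u]
  note Lu = is_wderiv_L2[OF du]
  \<comment> \<open>On \<open>H10\<close>, integration by parts turns \<open>pw m\<close> against
    \<open>wderiv \<phi>\<close> into \<open>m\<close> times \<open>pw (m - 1)\<close> against
    \<open>\<phi>\<close>, hence the division by \<open>m = n - 1\<close>. For \<open>n = 1\<close>
    there is no such term.\<close>
  define \<delta> where "\<delta> = (if n \<ge> 2 then gamma n u / of_nat m else 0)"
  define q where "q x = wderiv u x + \<delta> * pw m x" for x
  have q: "q \<in> L2" unfolding q_def[abs_def] by (intro L2_add L2_cmult L2_pw Lu)
  define w where "w \<phi> = form_a q (wderiv \<phi>)" for \<phi>
  \<comment> \<open>The constant produced by the power term in the derivative of \<open>Jn\<close>;
    testing \<open>w\<close> with \<open>Jn n \<phi>\<close> shows that \<open>\<kappa> - q\<close>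
    represents \<open>Pn n w\<close>.\<close>
  define \<kappa> where "\<kappa> = of_nat n * form_a q (pw m)"
  have wT: "w \<in> Hm1T"
    unfolding w_def[abs_def] by (rule form_a_functional_antidual[OF q]) (auto simp: H1T_def)
  have w1: "mu0H w = 0"
  proof -
    have "w (\<lambda>x. 1) = form_a q (\<lambda>x. 0)"
      unfolding w_def using wderiv_AE_eq[OF is_wderiv_const[of 1]] q
      by (intro form_a_cong_AE L2_const) (auto elim: eventually_mono)
    then show ?thesis by (simp add: mu0H_def form_a_const_right)
  qed
  have "w \<phi> = rhs_dist n u \<phi>" if \<phi>: "\<phi> \<in> H10" for \<phi>
  proof -
    have d: "is_wderiv \<phi> (wderiv \<phi>)" and "\<phi> 0 = 0"
      using \<phi> by (auto simp: H10_def intro: wderiv_is_wderiv)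
    have w: "w \<phi> = form_a (wderiv u) (wderiv \<phi>) + \<delta> * form_a (pw m) (wderiv \<phi>)"
      unfolding w_def q_def[abs_def] using is_wderiv_L2[OF d]
      by (simp add: form_a_add_left form_a_cmult_left L2_cmult L2_pw Lu)
    show ?thesis
    proof (cases m)
      case 0
      then show ?thesis using w by (simp add: rhs_dist_eq \<delta>_def m)
    next
      case (Suc k)
      have "form_a (pw m) (wderiv \<phi>) = cnj (form_a (wderiv \<phi>) (pw (Suc k)))"
        unfolding Suc by (rule form_a_commute)
      also have "\<dots> = of_nat m * form_a (pw k) \<phi>"
        using form_a_wderiv_pw[OF d, of k] \<open>\<phi> 0 = 0\<close> form_a_commute[of "pw k" \<phi>]
        by (simp add: Suc)
      finally show ?thesis
        using w Suc by (simp add: rhs_dist_eq \<delta>_def m del: of_nat_Suc)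
    qed
  qed
  with wT w1 have Idm: "Idm_inv_rel (rhs_dist n u) w"
    by (simp add: Idm_inv_rel_def)
  \<comment> \<open>For \<open>m = 0\<close> the constant may survive, but then its factor
    \<open>pw 1 x - pw n x\<close> in the final formula is zero.\<close>
  have \<kappa>: "\<kappa> = 0" if m0: "m \<noteq> 0"
  proof -
    obtain k where k: "m = Suc k" using m0 not0_implies_Suc by blast
    have "form_a q (pw m) = form_a (wderiv u) (pw m) + \<delta> * form_a (pw m) (pw m)"
      unfolding q_def[abs_def]
      by (simp add: form_a_add_left form_a_cmult_left L2_cmult L2_pw Lu)
    also have "form_a (wderiv u) (pw m) = of_nat m * mu k u - u 0"
      unfolding k mu_eq_form_a by (rule form_a_wderiv_pw[OF du])
    also have "form_a (pw m) (pw m) = 1 / of_nat (Suc (m + m))"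
      using mu_pw[of m m] by (simp add: mu_eq_form_a)
    \<comment> \<open>The factor \<open>2 m + 1\<close> in \<open>gamma\<close> is the inverse of
      the squared norm of \<open>pw m\<close>, so the \<open>\<delta>\<close> term cancels the inner
      product of \<open>wderiv u\<close> with \<open>pw m\<close>.\<close>
    also have "\<delta> = of_nat (Suc (m + m)) * (u 0 - of_nat m * mu k u)"
    proof -
      have "gamma n u = of_nat (m * Suc (m + m)) * u 0 - of_nat (m\<^sup>2 * Suc (m + m)) * mu k u"
      proof -
        have "2 * n - 1 = Suc (m + m)" "n - 1 = m" "n - 2 = k" "n \<ge> 2"
          using k m by auto
        then show ?thesis by (simp only: gamma_def if_True)
      qed
      also have "\<dots> = of_nat m * (of_nat (Suc (m + m)) * (u 0 - of_nat m * mu k u))"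
        by (simp add: power2_eq_square algebra_simps)
      finally show ?thesis
        using m0 k unfolding \<delta>_def by (simp add: m del: of_nat_Suc)
    qed
    finally have "form_a q (pw m) = 0"
      by (simp del: of_nat_Suc)
    then show ?thesis by (simp add: \<kappa>_def)
  qed
  define p where "p x = \<kappa> - q x" for x
  have p: "p \<in> L2" unfolding p_def[abs_def] by (intro L2_diff L2_const q)
  have "w (Jn n \<phi>) = form_a p \<phi>" if \<phi>: "\<phi> \<in> L2" for \<phi>
  proof -
    have "w (Jn n \<phi>) = form_a q (\<lambda>x. (of_nat n * mu 0 \<phi>) * pw m x - \<phi> x)"
      unfolding w_def using wderiv_AE_eq[OF is_wderiv_Jn[OF \<phi>, of m]] q
      by (intro form_a_cong_AE L2_diff L2_cmult L2_pw \<phi>)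
         (auto simp: m simp del: of_nat_Suc elim: eventually_mono)
    also have "\<dots> = cnj (of_nat n * mu 0 \<phi>) * form_a q (pw m) - form_a q \<phi>"
      using q \<phi> by (simp only: form_a_diff_right form_a_cmult_right L2_cmult L2_pw)
    also have "\<dots> = form_a p \<phi>"
      unfolding p_def[abs_def] using q \<phi>
      by (simp add: form_a_diff_left L2_const form_a_const_left \<kappa>_def)
    finally show ?thesis .
  qed
  from Pn_AE_eq(1,2)[where F = w, OF p this]
  have Pn: "Pn n w \<in> L2" "AE x in U. Pn n w x = p x" by auto
  have J: "Jn n (Pn n w) x = u x - u 1 + (u 1 - u 0) * pw n x" if x: "x \<in> {0..1}" for x
  proof -
    define N :: complex where "N = of_nat n"
    have prim_q: "prim q y = u y - u 0 + \<delta> * ((1 - pw n y) / N)" if "y \<in> {0..1}" for y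
      unfolding q_def[abs_def] using that
      by (simp add: prim_add prim_cmult L2_cmult L2_pw Lu is_wderiv_eq[OF du] prim_pw m N_def
          del: of_nat_Suc)
    have prim_const: "prim (\<lambda>x. \<kappa>) y = \<kappa> * (1 - pw 1 y)" if "y \<in> {0..1}" for y
      using prim_cmult[of \<kappa> "pw 0" y] prim_pw[OF that, of 0] by (simp add: pw_0)
    have prim_p: "prim p y = \<kappa> * (1 - pw 1 y) - (u y - u 0 + \<delta> * ((1 - pw n y) / N))"
      if "y \<in> {0..1}" for y
      unfolding p_def[abs_def] using that by (simp add: prim_diff L2_const q prim_q prim_const)
    have mu_p: "mu 0 p = \<kappa> - (u 1 - u 0 + \<delta> * (1 / N))"
      using prim_p[of 1] n by simp
    have "Jn n (Pn n w) x = mu 0 p * (1 - pw n x) - prim p x"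
      using Jn_cong_AE[OF p Pn(2) x] Jn_eq[OF p x] by simp
    \<comment> \<open>All terms with \<open>\<delta>\<close> cancel here.\<close>
    also have "\<dots> = \<kappa> * (pw 1 x - pw n x) + (u x - u 1 + (u 1 - u 0) * pw n x)"
      unfolding mu_p prim_p[OF x] by (simp add: algebra_simps diff_divide_distrib)
    also have "\<kappa> * (pw 1 x - pw n x) = 0"
      using \<kappa> m by (cases m) auto
    finally show ?thesis by simp
  qed
  have "w \<in> HY" using wT w1 by (simp add: HY_def)
  then show ?thesis using that Idm Pn(1) J by blast
qed

section \<open>The domain of the operator\<close>

text \<open>Subtracting the mean gives an admissible test function, which is then orthogonal to
  itself.\<close>

lemma orthogonal_mu_0_AE_const:
  assumes q: "q \<in> L2"
    and orth: "\<And>h. h \<in> L2 \<Longrightarrow> mu 0 h = 0 \<Longrightarrow> form_a q h = 0"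
  obtains c where "AE x in U. q x = c"
proof -
  define h where "h x = q x - mu 0 q" for x
  have h: "h \<in> L2" unfolding h_def[abs_def] by (intro L2_diff L2_const q)
  have h0: "mu 0 h = 0" unfolding h_def[abs_def] using q by (simp add: mu_diff L2_const mu_const)
  have "form_a h h = form_a q h - mu 0 q * cnj (mu 0 h)"
    by (subst (1) h_def[abs_def]) (simp add: form_a_diff_left q h L2_const form_a_const_left)
  then have "nsq h = 0" using orth[OF h h0] h0 by (simp add: form_a_self)
  then have "AE x in U. q x = mu 0 q"
    using nsq_eq_0_AE[OF h] by (simp add: h_def)
  then show ?thesis by (rule that)
qed

text \<open>Subtracting the orthogonal projection onto the span of 1 and \<open>(1 - x)^n\<close>
  leaves a function with both moments zero, hence orthogonal to itself.\<close>

lemma orthogonal_mu_0_mu_n_AE_span: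
  assumes q: "q \<in> L2" and n: "n \<ge> 1"
    and orth: "\<And>h. h \<in> L2 \<Longrightarrow> mu 0 h = 0 \<Longrightarrow> mu n h = 0 \<Longrightarrow> form_a q h = 0"
  obtains c d where "AE x in U. q x = c + d * pw n x"
proof -
  define N :: complex where "N = of_nat n"
  have nz: "N + 1 \<noteq> 0" "2 * N + 1 \<noteq> 0" "N \<noteq> 0"
  proof -
    have "complex_of_nat (Suc n) \<noteq> 0" "complex_of_nat (Suc (2 * n)) \<noteq> 0"
      by (simp_all only: of_nat_eq_0_iff)
    then show "N + 1 \<noteq> 0" "2 * N + 1 \<noteq> 0" by (simp_all add: N_def add.commute)
    show "N \<noteq> 0" using n by (simp add: N_def)
  qed
  \<comment> \<open>The Gram determinant of 1 and \<open>(1 - x)^n\<close>; the next identity shows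
    that it is nonzero.\<close>
  define D where "D = 1 / (2 * N + 1) - 1 / (N + 1)\<^sup>2"
  have "D * ((2 * N + 1) * (N + 1)\<^sup>2) = N\<^sup>2"
    using nz unfolding D_def by (simp add: left_diff_distrib) (simp add: power2_eq_square algebra_simps)
  then have D: "D \<noteq> 0" using nz by auto
  \<comment> \<open>\<open>c\<close> and \<open>d\<close> solve the 2x2 system that makes
    \<open>mu 0 h\<close> and \<open>mu n h\<close> vanish.\<close>
  define d where "d = (mu n q - mu 0 q / (N + 1)) / D"
  define c where "c = mu 0 q - d / (N + 1)"
  define h where "h x = q x - (c + d * pw n x)" for x
  have h: "h \<in> L2" unfolding h_def[abs_def] by (intro L2_diff L2_add L2_cmult L2_pw L2_const q)
  have mu_h: "mu k h = mu k q - (c / of_nat (Suc k) + d / of_nat (Suc (k + n)))" for k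
    unfolding h_def[abs_def] using q
    by (simp add: mu_diff mu_add mu_cmult mu_const mu_pw L2_const L2_add L2_cmult L2_pw)
  have h0: "mu 0 h = 0"
    unfolding mu_h by (simp add: c_def N_def add.commute)
  have "mu n h = mu n q - (c / (N + 1) + d / (2 * N + 1))"
  proof -
    have "of_nat (Suc n) = N + 1" "of_nat (Suc (n + n)) = 2 * N + 1"
      by (simp_all add: N_def)
    then show ?thesis unfolding mu_h by (simp only:)
  qed
  also have "\<dots> = mu n q - mu 0 q / (N + 1) - d * D"
    unfolding c_def D_def by (simp add: diff_divide_distrib right_diff_distrib power2_eq_square)
  also have "\<dots> = 0" using D by (simp add: d_def)
  finally have hn: "mu n h = 0" .
  have "form_a h h = form_a q h - (c * cnj (mu 0 h) + d * cnj (mu n h))"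
    by (subst (1) h_def[abs_def])
       (simp add: form_a_diff_left form_a_add_left form_a_cmult_left form_a_pw_left q h
         L2_const L2_add L2_cmult L2_pw form_a_const_left)
  then have "nsq h = 0" using orth[OF h h0 hn] h0 hn by (simp add: form_a_self)
  then have "AE x in U. q x = c + d * pw n x"
    using nsq_eq_0_AE[OF h] by (simp add: h_def)
  then show ?thesis by (rule that)
qed

lemma mu_cong_AE:
  assumes "f \<in> L2" "AE x in U. g x = f x"
  shows "mu k g = mu k f"
  unfolding mu_eq_form_a using assms
  by (intro form_a_cong_AE L2_pw) (auto elim: eventually_mono)

text \<open>The defining conditions on \<open>u\<close> involve it only through integrals, so they
  pass to every representative.\<close>

lemma AY_rel_cong_AE:
  assumes v: "AY_rel n Y v w" and eq: "AE x in U. u x = v x"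
  shows "AY_rel n Y u w"
proof -
  have L: "v \<in> L2" using v by (simp add: AY_rel_def VY_def)
  have "form_a u h = form_a v h" if "h \<in> L2" for h
    using L that eq by (intro form_a_cong_AE) (auto elim: eventually_mono)
  moreover have "u \<in> L2" by (rule L2_AE_eq[OF L eq])
  ultimately show ?thesis
    using v mu_cong_AE[OF L eq] by (simp add: AY_rel_def VY_def)
qed

lemma AY_rel_imp_H1:
  assumes rel: "AY_rel n Y u g" and n: "n \<ge> 1"
    and Y: "Y = {(0, 0)} \<or> Y = {0} \<times> UNIV"
  shows "\<exists>v\<in>H1. (AE x in U. u x = v x) \<and>
     (if Y = {(0, 0)} then mu 0 v = 0 \<and> mu n v = 0 else mu 0 v = 0 \<and> v 0 = v 1)"
proof -
  have u: "u \<in> L2" "(mu 0 u, mu n u) \<in> Y" and g: "g \<in> Hm1T" "mu0H g = 0"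
    and eq: "\<And>h. h \<in> VY n Y \<Longrightarrow> form_a u h = HY_inner n g (emb h)"
    using rel by (auto simp: AY_rel_def VY_def HY_def)
  define J where "J = Jn n (Pn n g)"
  note P = Pn_L2[OF g(1) n]
  have J: "J \<in> H1" "J \<in> L2" "J 0 = 0" "J 1 = 0"
    unfolding J_def using P n by (simp_all add: Jn_H1 H1_L2 Jn_boundary)
  define q where "q x = u x - J x" for x
  have q: "q \<in> L2" unfolding q_def[abs_def] by (intro L2_diff u J)
  have orth: "form_a q h = 0" if "h \<in> L2" "(mu 0 h, mu n h) \<in> Y" for h
  proof -
    have "form_a u h = form_a J h"
      using eq[of h] that HY_inner_emb[OF P that(1)] g by (simp add: VY_def J_def)
    then show ?thesis
      unfolding q_def[abs_def] using u J that by (simp add: form_a_diff_left)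
  qed
  have span: "\<exists>c d. (AE x in U. q x = c + d * pw n x) \<and> (Y \<noteq> {(0, 0)} \<longrightarrow> d = 0)"
  proof (cases "Y = {(0, 0)}")
    case True
    then show ?thesis
      using orthogonal_mu_0_mu_n_AE_span[OF q n] orth by (metis singletonI)
  next
    case False
    with Y have "\<And>h. h \<in> L2 \<Longrightarrow> mu 0 h = 0 \<Longrightarrow> form_a q h = 0"
      using orth by auto
    from orthogonal_mu_0_AE_const[OF q this] obtain c where "AE x in U. q x = c" by auto
    then show ?thesis by (intro exI[of _ c] exI[of _ 0]) simp
  qed
  then obtain c d where cd: "AE x in U. q x = c + d * pw n x" "Y \<noteq> {(0, 0)} \<Longrightarrow> d = 0"
    by auto
  define v where "v x = J x + (c + d * pw n x)" for x
  have "pw n \<in> H1" using is_wderiv_pw[of "n - 1"] n by (auto simp: H1_def)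
  then have v: "v \<in> H1"
    unfolding v_def[abs_def] using is_wderiv_const[of c]
    by (intro H1_add H1_cmult J) (auto simp: H1_def)
  have uv: "AE x in U. u x = v x"
    using cd(1) by (rule eventually_mono) (simp add: q_def v_def algebra_simps)
  have mu_v: "mu k v = mu k u" for k
    using mu_cong_AE[OF H1_L2[OF v] uv] by simp
  show ?thesis
  proof (intro bexI conjI)
    show "AE x in U. u x = v x" by fact
    \<comment> \<open>\<open>J\<close> vanishes at both endpoints and \<open>pw n\<close> is 1 at 0
      and 0 at 1, so \<open>v 0 - v 1 = d\<close>; the moments are inherited from
      \<open>u\<close>.\<close>
    show "if Y = {(0, 0)} then mu 0 v = 0 \<and> mu n v = 0 else mu 0 v = 0 \<and> v 0 = v 1"
      using u(2) Y cd(2) J(3,4) unfolding mu_v by (auto simp: v_def)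
    show "v \<in> H1" by fact
  qed
qed

text \<open>The difference of \<open>Jn n (Pn n w)\<close> and \<open>u\<close> is orthogonal to
  \<open>VY n Y\<close>: its constant part by \<open>mu 0 h = 0\<close>, its power part since either
  \<open>mu n h = 0\<close> or \<open>u 0 = u 1\<close>.\<close>

lemma H1_imp_AY_rel:
  assumes u: "u \<in> H1" and n: "n \<ge> 1"
    and Y: "Y = {(0, 0)} \<or> Y = {0} \<times> UNIV"
    and bc: "if Y = {(0, 0)} then mu 0 u = 0 \<and> mu n u = 0 else mu 0 u = 0 \<and> u 0 = u 1"
  shows "\<exists>w. Idm_inv_rel (rhs_dist n u) w \<and> AY_rel n Y u w"
proof -
  obtain w where w: "w \<in> HY" "Idm_inv_rel (rhs_dist n u) w" "Pn n w \<in> L2"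
    and J: "\<And>x. x \<in> {0..1} \<Longrightarrow> Jn n (Pn n w) x = u x - u 1 + (u 1 - u 0) * pw n x"
    using AY_solution[OF u n] by blast
  note Lu = H1_L2[OF u]
  have "form_a u h = HY_inner n w (emb h)" if "h \<in> VY n Y" for h
  proof -
    have h: "h \<in> L2" "mu 0 h = 0" and hn: "Y = {(0, 0)} \<Longrightarrow> mu n h = 0"
      using that Y by (auto simp: VY_def)
    have "form_a (Jn n (Pn n w)) h = form_a (\<lambda>x. (u x - u 1) + (u 1 - u 0) * pw n x) h"
      by (rule form_a_cong) (simp_all add: J)
    also have "\<dots> = form_a u h - u 1 * cnj (mu 0 h) + (u 1 - u 0) * cnj (mu n h)"
      using Lu h(1) by (simp add: form_a_add_left form_a_diff_left form_a_cmult_left form_a_pw_left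
          form_a_const_left L2_add L2_diff L2_cmult L2_pw L2_const)
    also have "\<dots> = form_a u h"
      using h hn bc by (auto split: if_splits)
    finally show ?thesis
      by (simp add: HY_inner_emb[OF w(3) h(1)] h(2))
  qed
  moreover have "u \<in> VY n Y"
    using bc Y Lu by (auto simp: VY_def split: if_splits)
  ultimately show ?thesis using w by (auto simp: AY_rel_def)
qed

text \<open>Members of \<open>H1\<close> are continuous on \<open>[0, 1]\<close>, whereas
  \<open>DAY\<close> contains every representative, hence the almost everywhere clause. The witness
  \<open>w\<close> expresses the formula for \<open>A_Y u\<close>, as both of its sides are encoded
  by relations.\<close>

theorem mainTheorem9:
  fixes n :: nat and Y :: "(complex \<times> complex) set"
  assumes "n \<ge> 1"
    and "Y = {(0, 0)} \<or> Y = {0} \<times> UNIV"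
  shows "(\<forall>u. u \<in> DAY n Y \<longleftrightarrow>
            (\<exists>v\<in>H1. (AE x in lebesgue_on {0..1}. u x = v x) \<and>
               (if Y = {(0, 0)} then mu 0 v = 0 \<and> mu n v = 0
                else mu 0 v = 0 \<and> v 0 = v 1)))
       \<and> (\<forall>u\<in>H1. (if Y = {(0, 0)} then mu 0 u = 0 \<and> mu n u = 0
                   else mu 0 u = 0 \<and> u 0 = u 1) \<longrightarrow>
            (\<exists>w. Idm_inv_rel (rhs_dist n u) w \<and> AY_rel n Y u w))"
proof (intro conjI allI ballI impI iffI)
  fix u assume "u \<in> DAY n Y"
  then show "\<exists>v\<in>H1. (AE x in lebesgue_on {0..1}. u x = v x) \<and>
      (if Y = {(0, 0)} then mu 0 v = 0 \<and> mu n v = 0 else mu 0 v = 0 \<and> v 0 = v 1)"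
    unfolding DAY_def using AY_rel_imp_H1[OF _ assms] by blast
next
  fix u assume "\<exists>v\<in>H1. (AE x in lebesgue_on {0..1}. u x = v x) \<and>
      (if Y = {(0, 0)} then mu 0 v = 0 \<and> mu n v = 0 else mu 0 v = 0 \<and> v 0 = v 1)"
  then show "u \<in> DAY n Y"
    unfolding DAY_def using H1_imp_AY_rel[OF _ assms] AY_rel_cong_AE by blast
next
  fix u assume "u \<in> H1" "if Y = {(0, 0)} then mu 0 u = 0 \<and> mu n u = 0 else mu 0 u = 0 \<and> u 0 = u 1"
  then show "\<exists>w. Idm_inv_rel (rhs_dist n u) w \<and> AY_rel n Y u w"
    by (rule H1_imp_AY_rel[OF _ assms])
qed

end
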